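(* Let $\mathcal{Q}$ be a small quantaloid. Cauchy completing, $\mathbb{A}\mapsto\mathbb{A}_{\mathsf{cc}}$, provides a left (bi)adjoint to the embedding $\mathsf{Cat}_{\mathsf{cc}}(\mathcal{Q})\to\mathsf{Cat}(\mathcal{Q})$. That is, for every $\mathcal{Q}$-category $\mathbb{A}$ the $\mathcal{Q}$-category $\mathbb{A}_{\mathsf{cc}}$ is Cauchy complete, and for every Cauchy complete $\mathcal{Q}$-category $\mathbb{B}$, composition with $i_{\mathbb{A}}:\mathbb{A}\to\mathbb{A}_{\mathsf{cc}}$ induces a natural equivalence of ordered sets $$\mathsf{Cat}_{\mathsf{cc}}(\mathcal{Q})(\mathbb{A}_{\mathsf{cc}},\mathbb{B})\longrightarrow\mathsf{Cat}(\mathcal{Q})(\mathbb{A},\mathbb{B}):G\mapsto G\circ i_{\mathbb{A}}.$$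
   Context: A sup-lattice is a partially ordered set in which every subset has a supremum. A quantaloid $\mathcal{Q}$ is a category whose hom-sets are sup-lattices and whose composition preserves arbitrary suprema in each variable; it is small if its objects form a set. In any quantaloid, for $g:B\to C$ and $h:A\to C$, $[g,h]:A\to B$ denotes the largest $x$ with $g\circ x\leq h$; an arrow $f:A\to B$ is left adjoint to $g:B\to A$ if $1_A\leq g\circ f$ and $f\circ g\leq 1_B$. A $\mathcal{Q}$-category $\mathbb{A}$ is a set $\mathbb{A}_0$ of objects, each $a$ having a type $ta\in\mathcal{Q}$, with arrows $\mathbb{A}(a',a):ta\to ta'$ in $\mathcal{Q}$ such that $\mathbb{A}(a'',a')\circ\mathbb{A}(a',a)\leq\mathbb{A}(a'',a)$ and $1_{ta}\leq\mathbb{A}(a,a)$. A distributor $\Phi:\mathbb{A}\nrightarrow\mathbb{B}$ is a family of arrows $\Phi(b,a):ta\to tb$ with $\mathbb{B}(b',b)\circ\Phi(b,a)\leq\Phi(b',a)$ and $\Phi(b,a)\circ\mathbb{A}(a,a')\leq\Phi(b,a')$. A functor $F:\mathbb{A}\to\mathbb{B}$ is a map $\mathbb{A}_0\to\mathbb{B}_0$ with $t(Fa)=ta$ and $\mathbb{A}(a',a)\leq\mathbb{B}(Fa',Fa)$. $\mathcal{Q}$-categories and distributors form a quantaloid $\mathsf{Dist}(\mathcal{Q})$ with composition $(\Psi\otimes_{\mathbb{B}}\Phi)(c,a)=\bigvee_{b}\Psi(c,b)\circ\Phi(b,a)$, identities $\mathbb{A}:\mathbb{A}\nrightarrow\mathbb{A}$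 (the hom-arrows), and elementwise order; $[-,-]$ is also used in $\mathsf{Dist}(\mathcal{Q})$. A functor $F:\mathbb{A}\to\mathbb{B}$ induces the distributor $\mathbb{B}(-,F-):\mathbb{A}\nrightarrow\mathbb{B}$. For functors $F,G:\mathbb{A}\to\mathbb{B}$ put $F\leq G$ iff $1_{ta}\leq\mathbb{B}(Fa,Ga)$ for all $a$ (equivalently $\mathbb{B}(-,F-)\leq\mathbb{B}(-,G-)$), and $F\cong G$ iff $F\leq G\leq F$; this makes $\mathcal{Q}$-categories and functors a locally ordered 2-category $\mathsf{Cat}(\mathcal{Q})$ ("order" means reflexive transitive relation; an equivalence of ordered sets is an order-preserving map having an order-preserving inverse up to $\cong$). For $C\in\mathcal{Q}$, $*_C$ is the one-object $\mathcal{Q}$-category of type $C$ with hom-arrow $1_C$. A distributor $\Phi:\mathbb{C}\nrightarrow\mathbb{A}$ is Cauchy if it has a right adjoint in $\mathsf{Dist}(\mathcal{Q})$; a Cauchy presheaf on $\mathbb{A}$ is a Cauchy distributor $\phi:*_C\nrightarrow\mathbb{A}$. $\mathbb{A}$ is Cauchy complete if for all $\mathbb{C}$ every Cauchy distributor $\Phi:\mathbb{C}\nrightarrow\mathbb{A}$ equals $\mathbb{A}(-,F-)$ for some functor $F:\mathbb{C}\to\mathbb{A}$. $\mathsf{Cat}_{\mathsf{cc}}(\mathcal{Q})$ is the full sub-2-category of $\mathsf{Cat}(\mathcal{Q})$ of Cauchy complete $\mathcal{Q}$-categories. The Cauchy completion $\mathbb{A}_{\mathsf{cc}}$ is the $\mathcal{Q}$-category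 whose objects of type $C$ are the Cauchy presheaves $\phi:*_C\nrightarrow\mathbb{A}$, with $\mathbb{A}_{\mathsf{cc}}(\psi,\phi)$ the single element of $[\psi,\phi]$; $i_{\mathbb{A}}:\mathbb{A}\to\mathbb{A}_{\mathsf{cc}}$ sends $a$ to $\mathbb{A}(-,a):*_{ta}\nrightarrow\mathbb{A}$. *)

theory Defs
  imports Main "HOL-Library.FuncSet"
begin

section \<open>Sup-lattices and quantaloids\<close>

definition is_sup :: "'x set \<Rightarrow> ('x \<Rightarrow> 'x \<Rightarrow> bool) \<Rightarrow> 'x set \<Rightarrow> 'x \<Rightarrow> bool" where
  "is_sup X le S s \<longleftrightarrow>
     s \<in> X \<and> (\<forall>x\<in>S. le x s) \<and> (\<forall>u\<in>X. (\<forall>x\<in>S. le x u) \<longrightarrow> le s u)"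

definition sup_lattice :: "'x set \<Rightarrow> ('x \<Rightarrow> 'x \<Rightarrow> bool) \<Rightarrow> bool" where
  "sup_lattice X le \<longleftrightarrow>
     reflp_on X le \<and> transp_on X le \<and> antisymp_on X le \<and> (\<forall>S\<subseteq>X. \<exists>s. is_sup X le S s)"

record ('o, 'm) quantaloid_data =
  Ob :: "'o set"
  Arr :: "'m set"
  Dom :: "'m \<Rightarrow> 'o"
  Cod :: "'m \<Rightarrow> 'o"
  Ident :: "'o \<Rightarrow> 'm"
  Comp :: "'m \<Rightarrow> 'm \<Rightarrow> 'm" (infixl "\<cdot>\<index>" 70)
  Leq :: "'m \<Rightarrow> 'm \<Rightarrow> bool" (infix "\<sqsubseteq>\<index>" 50)

definition Hom :: "('o, 'm) quantaloid_data \<Rightarrow> 'o \<Rightarrow> 'o \<Rightarrow> 'm set" where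
  "Hom Q A B = {f \<in> Arr Q. Dom Q f = A \<and> Cod Q f = B}"

text \<open>As usual, \<open>g \<cdot> f\<close> is ``\<open>g\<close> after \<open>f\<close>''. The relation \<open>\<sqsubseteq>\<close> is only
  meaningful between parallel arrows.\<close>

locale quantaloid =
  fixes Q :: "('o, 'm) quantaloid_data" (structure)
  assumes dom_cod_closed: "f \<in> Arr Q \<Longrightarrow> Dom Q f \<in> Ob Q \<and> Cod Q f \<in> Ob Q"
    and ident_closed: "A \<in> Ob Q \<Longrightarrow> Ident Q A \<in> Hom Q A A"
    and comp_closed: "\<lbrakk>g \<in> Hom Q B C; f \<in> Hom Q A B\<rbrakk> \<Longrightarrow> g \<cdot> f \<in> Hom Q A C"
    and comp_assoc: "\<lbrakk>h \<in> Hom Q C D; g \<in> Hom Q B C; f \<in> Hom Q A B\<rbrakk>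
      \<Longrightarrow> h \<cdot> (g \<cdot> f) = (h \<cdot> g) \<cdot> f"
    and comp_ident_right: "f \<in> Hom Q A B \<Longrightarrow> f \<cdot> Ident Q A = f"
    and comp_ident_left: "f \<in> Hom Q A B \<Longrightarrow> Ident Q B \<cdot> f = f"
    and hom_sup_lattice: "\<lbrakk>A \<in> Ob Q; B \<in> Ob Q\<rbrakk> \<Longrightarrow> sup_lattice (Hom Q A B) (\<sqsubseteq>)"
    and comp_sup_left: "\<lbrakk>f \<in> Hom Q A B; C \<in> Ob Q; S \<subseteq> Hom Q B C; is_sup (Hom Q B C) (\<sqsubseteq>) S s\<rbrakk>
      \<Longrightarrow> is_sup (Hom Q A C) (\<sqsubseteq>) ((\<lambda>g. g \<cdot> f) ` S) (s \<cdot> f)"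
    and comp_sup_right: "\<lbrakk>g \<in> Hom Q B C; A \<in> Ob Q; S \<subseteq> Hom Q A B; is_sup (Hom Q A B) (\<sqsubseteq>) S s\<rbrakk>
      \<Longrightarrow> is_sup (Hom Q A C) (\<sqsubseteq>) ((\<lambda>f. g \<cdot> f) ` S) (g \<cdot> s)"

definition Join :: "('o, 'm) quantaloid_data \<Rightarrow> 'o \<Rightarrow> 'o \<Rightarrow> 'm set \<Rightarrow> 'm" where
  "Join Q A B S = (THE s. is_sup (Hom Q A B) (Leq Q) S s)"


section \<open>Enriched categories, distributors and functors\<close>

text \<open>The arrow \<open>hom A a' a\<close> goes from the type of \<open>a\<close> to the type of \<open>a'\<close>.\<close>

record ('o, 'm, 'a) qcat =
  Objs :: "'a set"
  ty :: "'a \<Rightarrow> 'o"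
  hom :: "'a \<Rightarrow> 'a \<Rightarrow> 'm"

definition q_category :: "('o, 'm) quantaloid_data \<Rightarrow> ('o, 'm, 'a) qcat \<Rightarrow> bool" where
  "q_category Q A \<longleftrightarrow>
     (\<forall>a\<in>Objs A. ty A a \<in> Ob Q) \<and>
     (\<forall>a'\<in>Objs A. \<forall>a\<in>Objs A. hom A a' a \<in> Hom Q (ty A a) (ty A a')) \<and>
     (\<forall>a''\<in>Objs A. \<forall>a'\<in>Objs A. \<forall>a\<in>Objs A. hom A a'' a' \<cdot>\<^bsub>Q\<^esub> hom A a' a \<sqsubseteq>\<^bsub>Q\<^esub> hom A a'' a) \<and>
     (\<forall>a\<in>Objs A. Ident Q (ty A a) \<sqsubseteq>\<^bsub>Q\<^esub> hom A a a)"

text \<open>A distributor from \<open>A\<close> to \<open>B\<close> is a function on \<open>Objs B \<times> Objs A\<close>. Distributors and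
  functors are required to be extensional, so that equality of HOL functions is equality of
  distributors and of functors.\<close>

definition distributor ::
  "('o, 'm) quantaloid_data \<Rightarrow> ('o, 'm, 'a) qcat \<Rightarrow> ('o, 'm, 'b) qcat \<Rightarrow> ('b \<times> 'a \<Rightarrow> 'm) \<Rightarrow> bool" where
  "distributor Q A B \<Phi> \<longleftrightarrow>
     \<Phi> \<in> extensional (Objs B \<times> Objs A) \<and>
     (\<forall>b\<in>Objs B. \<forall>a\<in>Objs A. \<Phi> (b, a) \<in> Hom Q (ty A a) (ty B b)) \<and>
     (\<forall>b'\<in>Objs B. \<forall>b\<in>Objs B. \<forall>a\<in>Objs A. hom B b' b \<cdot>\<^bsub>Q\<^esub> \<Phi> (b, a) \<sqsubseteq>\<^bsub>Q\<^esub> \<Phi> (b', a)) \<and>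
     (\<forall>b\<in>Objs B. \<forall>a\<in>Objs A. \<forall>a'\<in>Objs A. \<Phi> (b, a) \<cdot>\<^bsub>Q\<^esub> hom A a a' \<sqsubseteq>\<^bsub>Q\<^esub> \<Phi> (b, a'))"

definition dist_le ::
  "('o, 'm) quantaloid_data \<Rightarrow> ('o, 'm, 'a) qcat \<Rightarrow> ('o, 'm, 'b) qcat
    \<Rightarrow> ('b \<times> 'a \<Rightarrow> 'm) \<Rightarrow> ('b \<times> 'a \<Rightarrow> 'm) \<Rightarrow> bool" where
  "dist_le Q A B \<Phi> \<Psi> \<longleftrightarrow> (\<forall>b\<in>Objs B. \<forall>a\<in>Objs A. \<Phi> (b, a) \<sqsubseteq>\<^bsub>Q\<^esub> \<Psi> (b, a))"

definition dist_id :: "('o, 'm, 'a) qcat \<Rightarrow> ('a \<times> 'a \<Rightarrow> 'm)" where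
  "dist_id A = (\<lambda>(a', a)\<in>Objs A \<times> Objs A. hom A a' a)"

text \<open>\<open>dist_comp Q A B C \<Psi> \<Phi>\<close> is the composite of \<open>\<Phi>\<close> from \<open>A\<close> to \<open>B\<close> followed by \<open>\<Psi>\<close> from
  \<open>B\<close> to \<open>C\<close>.\<close>

definition dist_comp ::
  "('o, 'm) quantaloid_data \<Rightarrow> ('o, 'm, 'a) qcat \<Rightarrow> ('o, 'm, 'b) qcat \<Rightarrow> ('o, 'm, 'c) qcat
    \<Rightarrow> ('c \<times> 'b \<Rightarrow> 'm) \<Rightarrow> ('b \<times> 'a \<Rightarrow> 'm) \<Rightarrow> ('c \<times> 'a \<Rightarrow> 'm)" where
  "dist_comp Q A B C \<Psi> \<Phi> =
     (\<lambda>(c, a)\<in>Objs C \<times> Objs A.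
        Join Q (ty A a) (ty C c) ((\<lambda>b. \<Psi> (c, b) \<cdot>\<^bsub>Q\<^esub> \<Phi> (b, a)) ` Objs B))"

text \<open>\<open>dist_lift Q A B C \<Psi> \<Phi>\<close> is the lifting \<open>[\<Psi>, \<Phi>]\<close> from \<open>A\<close> to \<open>B\<close>, for \<open>\<Psi>\<close> from \<open>B\<close> to \<open>C\<close>
  and \<open>\<Phi>\<close> from \<open>A\<close> to \<open>C\<close>.\<close>

definition dist_lift ::
  "('o, 'm) quantaloid_data \<Rightarrow> ('o, 'm, 'a) qcat \<Rightarrow> ('o, 'm, 'b) qcat \<Rightarrow> ('o, 'm, 'c) qcat
    \<Rightarrow> ('c \<times> 'b \<Rightarrow> 'm) \<Rightarrow> ('c \<times> 'a \<Rightarrow> 'm) \<Rightarrow> ('b \<times> 'a \<Rightarrow> 'm)" where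
  "dist_lift Q A B C \<Psi> \<Phi> =
     (THE X. distributor Q A B X \<and> dist_le Q A C (dist_comp Q A B C \<Psi> X) \<Phi> \<and>
        (\<forall>Y. distributor Q A B Y \<and> dist_le Q A C (dist_comp Q A B C \<Psi> Y) \<Phi> \<longrightarrow> dist_le Q A B Y X))"

definition q_functor ::
  "('o, 'm) quantaloid_data \<Rightarrow> ('o, 'm, 'a) qcat \<Rightarrow> ('o, 'm, 'b) qcat \<Rightarrow> ('a \<Rightarrow> 'b) \<Rightarrow> bool" where
  "q_functor Q A B F \<longleftrightarrow>
     F \<in> Objs A \<rightarrow>\<^sub>E Objs B \<and>
     (\<forall>a\<in>Objs A. ty B (F a) = ty A a) \<and>
     (\<forall>a'\<in>Objs A. \<forall>a\<in>Objs A. hom A a' a \<sqsubseteq>\<^bsub>Q\<^esub> hom B (F a') (F a))"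

definition Functors ::
  "('o, 'm) quantaloid_data \<Rightarrow> ('o, 'm, 'a) qcat \<Rightarrow> ('o, 'm, 'b) qcat \<Rightarrow> ('a \<Rightarrow> 'b) set" where
  "Functors Q A B = {F. q_functor Q A B F}"

definition functor_le ::
  "('o, 'm) quantaloid_data \<Rightarrow> ('o, 'm, 'a) qcat \<Rightarrow> ('o, 'm, 'b) qcat
    \<Rightarrow> ('a \<Rightarrow> 'b) \<Rightarrow> ('a \<Rightarrow> 'b) \<Rightarrow> bool" where
  "functor_le Q A B F G \<longleftrightarrow> (\<forall>a\<in>Objs A. Ident Q (ty A a) \<sqsubseteq>\<^bsub>Q\<^esub> hom B (F a) (G a))"

definition functor_id :: "('o, 'm, 'a) qcat \<Rightarrow> ('a \<Rightarrow> 'a)" where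
  "functor_id A = (\<lambda>a\<in>Objs A. a)"

definition functor_comp :: "('o, 'm, 'a) qcat \<Rightarrow> ('b \<Rightarrow> 'c) \<Rightarrow> ('a \<Rightarrow> 'b) \<Rightarrow> ('a \<Rightarrow> 'c)" where
  "functor_comp A G F = compose (Objs A) G F"

definition functor_dist :: "('o, 'm, 'a) qcat \<Rightarrow> ('o, 'm, 'b) qcat \<Rightarrow> ('a \<Rightarrow> 'b) \<Rightarrow> ('b \<times> 'a \<Rightarrow> 'm)" where
  "functor_dist A B F = (\<lambda>(b, a)\<in>Objs B \<times> Objs A. hom B b (F a))"

definition star :: "('o, 'm) quantaloid_data \<Rightarrow> 'o \<Rightarrow> ('o, 'm, unit) qcat" where
  "star Q C = \<lparr>Objs = {()}, ty = (\<lambda>_. C), hom = (\<lambda>_ _. Ident Q C)\<rparr>"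


section \<open>Cauchy completeness and Cauchy completion\<close>

definition dist_left_adjoint ::
  "('o, 'm) quantaloid_data \<Rightarrow> ('o, 'm, 'a) qcat \<Rightarrow> ('o, 'm, 'b) qcat
    \<Rightarrow> ('b \<times> 'a \<Rightarrow> 'm) \<Rightarrow> ('a \<times> 'b \<Rightarrow> 'm) \<Rightarrow> bool" where
  "dist_left_adjoint Q A B \<Phi> \<Psi> \<longleftrightarrow>
     distributor Q A B \<Phi> \<and> distributor Q B A \<Psi> \<and>
     dist_le Q A A (dist_id A) (dist_comp Q A B A \<Psi> \<Phi>) \<and>
     dist_le Q B B (dist_comp Q B A B \<Phi> \<Psi>) (dist_id B)"

definition cauchy_distributor ::
  "('o, 'm) quantaloid_data \<Rightarrow> ('o, 'm, 'a) qcat \<Rightarrow> ('o, 'm, 'b) qcat \<Rightarrow> ('b \<times> 'a \<Rightarrow> 'm) \<Rightarrow> bool" where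
  "cauchy_distributor Q A B \<Phi> \<longleftrightarrow> (\<exists>\<Psi>. dist_left_adjoint Q A B \<Phi> \<Psi>)"

text \<open>A HOL definition cannot quantify over types, so the type \<open>'c\<close> that contains the objects of
  the test categories \<open>C\<close> is a parameter.\<close>

definition cauchy_complete ::
  "'c itself \<Rightarrow> ('o, 'm) quantaloid_data \<Rightarrow> ('o, 'm, 'a) qcat \<Rightarrow> bool" where
  "cauchy_complete T Q A \<longleftrightarrow>
     q_category Q A \<and>
     (\<forall>(C :: ('o, 'm, 'c) qcat) \<Phi>.
        q_category Q C \<and> cauchy_distributor Q C A \<Phi> \<longrightarrow>
        (\<exists>F. q_functor Q C A F \<and> \<Phi> = functor_dist C A F))"

text \<open>An object of type \<open>C\<close> of the completion is the pair of \<open>C\<close> and a Cauchy presheaf; \<open>C\<close> is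
  recorded because it cannot be recovered from the underlying function if \<open>A\<close> has no objects.\<close>

definition cauchy_completion ::
  "('o, 'm) quantaloid_data \<Rightarrow> ('o, 'm, 'a) qcat \<Rightarrow> ('o, 'm, 'o \<times> ('a \<times> unit \<Rightarrow> 'm)) qcat" where
  "cauchy_completion Q A =
     \<lparr>Objs = {(C, \<phi>). C \<in> Ob Q \<and> cauchy_distributor Q (star Q C) A \<phi>},
      ty = fst,
      hom = (\<lambda>(D, \<psi>) (C, \<phi>). dist_lift Q (star Q C) (star Q D) A \<psi> \<phi> ((), ()))\<rparr>"

definition cc_unit ::
  "('o, 'm) quantaloid_data \<Rightarrow> ('o, 'm, 'a) qcat \<Rightarrow> ('a \<Rightarrow> 'o \<times> ('a \<times> unit \<Rightarrow> 'm))" where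
  "cc_unit Q A = (\<lambda>a\<in>Objs A. (ty A a, \<lambda>(x, u)\<in>Objs A \<times> {()}. hom A x a))"

text \<open>The action of Cauchy completion on a functor \<open>F\<close> from \<open>A\<close> to \<open>B\<close>: it composes Cauchy
  presheaves on \<open>A\<close> with the distributor \<open>B(-,F-)\<close>.\<close>

definition cc_map ::
  "('o, 'm) quantaloid_data \<Rightarrow> ('o, 'm, 'a) qcat \<Rightarrow> ('o, 'm, 'b) qcat \<Rightarrow> ('a \<Rightarrow> 'b)
    \<Rightarrow> ('o \<times> ('a \<times> unit \<Rightarrow> 'm) \<Rightarrow> 'o \<times> ('b \<times> unit \<Rightarrow> 'm))" where
  "cc_map Q A B F =
     (\<lambda>(C, \<phi>)\<in>Objs (cauchy_completion Q A).
        (C, dist_comp Q (star Q C) A B (functor_dist A B F) \<phi>))"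

definition cc_restrict ::
  "('o, 'm) quantaloid_data \<Rightarrow> ('o, 'm, 'a) qcat
    \<Rightarrow> ('o \<times> ('a \<times> unit \<Rightarrow> 'm) \<Rightarrow> 'b) \<Rightarrow> ('a \<Rightarrow> 'b)" where
  "cc_restrict Q A G = functor_comp A G (cc_unit Q A)"


section \<open>Equivalences of ordered sets\<close>

definition order_preserving ::
  "'x set \<Rightarrow> ('x \<Rightarrow> 'x \<Rightarrow> bool) \<Rightarrow> 'y set \<Rightarrow> ('y \<Rightarrow> 'y \<Rightarrow> bool) \<Rightarrow> ('x \<Rightarrow> 'y) \<Rightarrow> bool" where
  "order_preserving X leX Y leY f \<longleftrightarrow>
     f \<in> X \<rightarrow> Y \<and> (\<forall>x\<in>X. \<forall>x'\<in>X. leX x x' \<longrightarrow> leY (f x) (f x'))"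

definition order_equivalence ::
  "'x set \<Rightarrow> ('x \<Rightarrow> 'x \<Rightarrow> bool) \<Rightarrow> 'y set \<Rightarrow> ('y \<Rightarrow> 'y \<Rightarrow> bool) \<Rightarrow> ('x \<Rightarrow> 'y) \<Rightarrow> bool" where
  "order_equivalence X leX Y leY f \<longleftrightarrow>
     order_preserving X leX Y leY f \<and>
     (\<exists>g. order_preserving Y leY X leX g \<and>
        (\<forall>x\<in>X. leX (g (f x)) x \<and> leX x (g (f x))) \<and>
        (\<forall>y\<in>Y. leY (f (g y)) y \<and> leY y (f (g y))))"

end

theory Submission
  imports Defs
begin

text \<open>
  The theorem is an isomorphism in the quantaloid of distributors. Let \<open>i\<close> be the unit
  \<open>A \<rightarrow> A\<^sub>c\<^sub>c\<close>. It induces a distributor \<open>J = A\<^sub>c\<^sub>c(-,i-)\<close> with right adjoint \<open>J' = A\<^sub>c\<^sub>c(i-,-)\<close>.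
  By the Yoneda lemma \<open>J'(a,\<phi>) = \<phi>(a)\<close> and \<open>J(\<psi>,a) = \<psi>'(a)\<close>, where \<open>\<psi>'\<close> is the right adjoint of the
  Cauchy presheaf \<open>\<psi>\<close>. Since lifting through a left adjoint is composition with its right adjoint
  (\<open>dist_lift_left_adjoint\<close>), the hom-arrow \<open>A\<^sub>c\<^sub>c(\<psi>,\<phi>)\<close> is the supremum of \<open>\<psi>'(a) \<cdot> \<phi>(a)\<close>, which is
  \<open>(J \<otimes> J')(\<psi>,\<phi>)\<close>. So \<open>J \<otimes> J'\<close> is the identity (\<open>unit_dist_unit_codist\<close>), and \<open>J' \<otimes> J\<close> is the
  identity because \<open>i\<close> is fully faithful (\<open>unit_codist_unit_dist\<close>).

  Completeness: a \<open>Q\<close>-category is Cauchy complete as soon as every Cauchy presheaf on it is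
  representable (\<open>cauchy_completeI\<close>). A Cauchy presheaf \<open>\<Phi>\<close> on \<open>A\<^sub>c\<^sub>c\<close> yields the Cauchy presheaf
  \<open>J' \<otimes> \<Phi>\<close> on \<open>A\<close>, which is an object of \<open>A\<^sub>c\<^sub>c\<close> and represents \<open>J \<otimes> J' \<otimes> \<Phi> = \<Phi>\<close>.

  Universal property: the assignment \<open>F \<mapsto> B(-,F-)\<close> turns composition of functors into composition
  of distributors and reflects the order (\<open>functor_le_iff_dist_le\<close>), and for a Cauchy complete \<open>B\<close>
  its image consists of all Cauchy distributors. Restriction along \<open>i\<close> thus becomes composition
  with the isomorphism \<open>J\<close>, and composition with \<open>J'\<close> provides the inverse equivalence. As Cauchy
  completeness is tested on presheaves, it does not depend on the type from which the objects of
  the test categories are drawn (\<open>cauchy_complete_type_independent\<close>); this allows to apply it to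
  distributors out of \<open>A\<^sub>c\<^sub>c\<close>.

  Naturality: \<open>cc_map\<close> sends \<open>F\<close> to the functor that corresponds to
  \<open>J \<otimes> B(-,F-) \<otimes> J'\<close> (\<open>functor_dist_cc_map\<close>), and it sends representables to representables.
\<close>

section \<open>Suprema in hom-sets\<close>

lemma (in quantaloid) leq_refl: "f \<in> Hom Q A B \<Longrightarrow> f \<sqsubseteq> f"
  and leq_trans: "\<lbrakk>f \<sqsubseteq> g; g \<sqsubseteq> h; f \<in> Hom Q A B; g \<in> Hom Q A B; h \<in> Hom Q A B\<rbrakk> \<Longrightarrow> f \<sqsubseteq> h"
  and leq_antisym: "\<lbrakk>f \<sqsubseteq> g; g \<sqsubseteq> f; f \<in> Hom Q A B; g \<in> Hom Q A B\<rbrakk> \<Longrightarrow> f = g"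
  and Hom_Ob: "f \<in> Hom Q A B \<Longrightarrow> A \<in> Ob Q \<and> B \<in> Ob Q"
proof -
  have ob: "A \<in> Ob Q \<and> B \<in> Ob Q" if "f \<in> Hom Q A B" for f
    using that dom_cod_closed by (auto simp: Hom_def)
  have sl: "sup_lattice (Hom Q A B) (\<sqsubseteq>)" if "f \<in> Hom Q A B" for f
    using ob[OF that] hom_sup_lattice by blast
  show "f \<in> Hom Q A B \<Longrightarrow> A \<in> Ob Q \<and> B \<in> Ob Q" by (rule ob)
  show "f \<in> Hom Q A B \<Longrightarrow> f \<sqsubseteq> f"
    using sl[of f] unfolding sup_lattice_def by (auto dest: reflp_onD)
  show "\<lbrakk>f \<sqsubseteq> g; g \<sqsubseteq> h; f \<in> Hom Q A B; g \<in> Hom Q A B; h \<in> Hom Q A B\<rbrakk> \<Longrightarrow> f \<sqsubseteq> h"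
    using sl[of f] unfolding sup_lattice_def by (meson transp_onD)
  show "\<lbrakk>f \<sqsubseteq> g; g \<sqsubseteq> f; f \<in> Hom Q A B; g \<in> Hom Q A B\<rbrakk> \<Longrightarrow> f = g"
    using sl[of f] unfolding sup_lattice_def by (meson antisymp_onD)
qed

lemma (in quantaloid) is_sup_Join:
  assumes "A \<in> Ob Q" "B \<in> Ob Q" "S \<subseteq> Hom Q A B"
  shows "is_sup (Hom Q A B) (\<sqsubseteq>) S (Join Q A B S)"
proof -
  obtain s where s: "is_sup (Hom Q A B) (\<sqsubseteq>) S s"
    using hom_sup_lattice[OF assms(1,2)] assms(3) unfolding sup_lattice_def by blast
  have "t = s" if "is_sup (Hom Q A B) (\<sqsubseteq>) S t" for t
    using s that leq_antisym unfolding is_sup_def by blast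
  then have "Join Q A B S = s" unfolding Join_def using s by blast
  then show ?thesis using s by simp
qed

lemma (in quantaloid) Join_closed:
    "\<lbrakk>A \<in> Ob Q; B \<in> Ob Q; S \<subseteq> Hom Q A B\<rbrakk> \<Longrightarrow> Join Q A B S \<in> Hom Q A B"
  and Join_upper:
    "\<lbrakk>A \<in> Ob Q; B \<in> Ob Q; S \<subseteq> Hom Q A B; s \<in> S\<rbrakk> \<Longrightarrow> s \<sqsubseteq> Join Q A B S"
  using is_sup_Join[of A B S] by (auto simp: is_sup_def)

lemma (in quantaloid) is_sup_le_iff:
  assumes "is_sup (Hom Q A B) (\<sqsubseteq>) S s" "S \<subseteq> Hom Q A B" "x \<in> Hom Q A B"
  shows "s \<sqsubseteq> x \<longleftrightarrow> (\<forall>t\<in>S. t \<sqsubseteq> x)"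
proof
  assume "s \<sqsubseteq> x"
  then show "\<forall>t\<in>S. t \<sqsubseteq> x" using assms leq_trans unfolding is_sup_def by blast
qed (use assms in \<open>auto simp: is_sup_def\<close>)

lemma (in quantaloid) Join_le_iff:
  "\<lbrakk>A \<in> Ob Q; B \<in> Ob Q; S \<subseteq> Hom Q A B; x \<in> Hom Q A B\<rbrakk>
    \<Longrightarrow> Join Q A B S \<sqsubseteq> x \<longleftrightarrow> (\<forall>t\<in>S. t \<sqsubseteq> x)"
  using is_sup_le_iff is_sup_Join by blast

lemma (in quantaloid) comp_Join_le_iff:
  assumes "g \<in> Hom Q B C" "A \<in> Ob Q" "S \<subseteq> Hom Q A B" "x \<in> Hom Q A C"
  shows "g \<cdot> Join Q A B S \<sqsubseteq> x \<longleftrightarrow> (\<forall>s\<in>S. g \<cdot> s \<sqsubseteq> x)"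
proof -
  have "is_sup (Hom Q A C) (\<sqsubseteq>) ((\<lambda>f. g \<cdot> f) ` S) (g \<cdot> Join Q A B S)"
    using assms(1-3) Hom_Ob[OF assms(1)] by (simp add: comp_sup_right is_sup_Join)
  moreover have "(\<lambda>f. g \<cdot> f) ` S \<subseteq> Hom Q A C"
    using comp_closed[OF assms(1)] assms(3) by auto
  ultimately show ?thesis using is_sup_le_iff[OF _ _ assms(4)] by simp
qed

lemma (in quantaloid) Join_comp_le_iff:
  assumes "f \<in> Hom Q A B" "C \<in> Ob Q" "S \<subseteq> Hom Q B C" "x \<in> Hom Q A C"
  shows "Join Q B C S \<cdot> f \<sqsubseteq> x \<longleftrightarrow> (\<forall>s\<in>S. s \<cdot> f \<sqsubseteq> x)"
proof -
  have "is_sup (Hom Q A C) (\<sqsubseteq>) ((\<lambda>g. g \<cdot> f) ` S) (Join Q B C S \<cdot> f)"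
    using assms(1-3) Hom_Ob[OF assms(1)] by (simp add: comp_sup_left is_sup_Join)
  moreover have "(\<lambda>g. g \<cdot> f) ` S \<subseteq> Hom Q A C"
    using comp_closed[OF _ assms(1)] assms(3) by auto
  ultimately show ?thesis using is_sup_le_iff[OF _ _ assms(4)] by simp
qed

text \<open>Equality of composites that involve suprema is tested on upper bounds, which the \<open>le_iff\<close>
  lemmas above push down to the individual terms.\<close>

lemma (in quantaloid) eq_by_upper_bounds:
  assumes "f \<in> Hom Q A B" "g \<in> Hom Q A B" "\<And>x. x \<in> Hom Q A B \<Longrightarrow> f \<sqsubseteq> x \<longleftrightarrow> g \<sqsubseteq> x"
  shows "f = g"
  using assms leq_antisym leq_refl by blast

text \<open>Composition preserves the supremum of a pair \<open>f \<sqsubseteq> f'\<close>, hence is monotone.\<close>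

lemma (in quantaloid) comp_mono_right:
  assumes "f \<sqsubseteq> f'" "f \<in> Hom Q A B" "f' \<in> Hom Q A B" "g \<in> Hom Q B C"
  shows "g \<cdot> f \<sqsubseteq> g \<cdot> f'"
proof -
  have "is_sup (Hom Q A B) (\<sqsubseteq>) {f, f'} f'"
    using assms leq_refl by (auto simp: is_sup_def)
  then have "is_sup (Hom Q A C) (\<sqsubseteq>) ((\<lambda>f. g \<cdot> f) ` {f, f'}) (g \<cdot> f')"
    using assms Hom_Ob[OF assms(2)] by (intro comp_sup_right) simp_all
  then show ?thesis by (simp add: is_sup_def)
qed

lemma (in quantaloid) comp_mono_left:
  assumes "g \<sqsubseteq> g'" "g \<in> Hom Q B C" "g' \<in> Hom Q B C" "f \<in> Hom Q A B"
  shows "g \<cdot> f \<sqsubseteq> g' \<cdot> f"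
proof -
  have "is_sup (Hom Q B C) (\<sqsubseteq>) {g, g'} g'"
    using assms leq_refl by (auto simp: is_sup_def)
  then have "is_sup (Hom Q A C) (\<sqsubseteq>) ((\<lambda>g. g \<cdot> f) ` {g, g'}) (g' \<cdot> f)"
    using assms Hom_Ob[OF assms(2)] by (intro comp_sup_left) simp_all
  then show ?thesis by (simp add: is_sup_def)
qed

lemma (in quantaloid) comp_mono:
  assumes "g \<sqsubseteq> g'" "f \<sqsubseteq> f'" "g \<in> Hom Q B C" "g' \<in> Hom Q B C" "f \<in> Hom Q A B" "f' \<in> Hom Q A B"
  shows "g \<cdot> f \<sqsubseteq> g' \<cdot> f'"
  using assms comp_mono_left comp_mono_right comp_closed leq_trans by meson


section \<open>The quantaloid of distributors\<close>

lemma q_categoryD: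
  assumes "q_category Q A"
  shows "a \<in> Objs A \<Longrightarrow> ty A a \<in> Ob Q"
    and "\<lbrakk>a' \<in> Objs A; a \<in> Objs A\<rbrakk> \<Longrightarrow> hom A a' a \<in> Hom Q (ty A a) (ty A a')"
    and "\<lbrakk>a'' \<in> Objs A; a' \<in> Objs A; a \<in> Objs A\<rbrakk>
      \<Longrightarrow> hom A a'' a' \<cdot>\<^bsub>Q\<^esub> hom A a' a \<sqsubseteq>\<^bsub>Q\<^esub> hom A a'' a"
    and "a \<in> Objs A \<Longrightarrow> Ident Q (ty A a) \<sqsubseteq>\<^bsub>Q\<^esub> hom A a a"
  using assms by (auto simp: q_category_def)

lemma distributorD:
  assumes "distributor Q A B \<Phi>"
  shows "\<Phi> \<in> extensional (Objs B \<times> Objs A)"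
    and "\<lbrakk>b \<in> Objs B; a \<in> Objs A\<rbrakk> \<Longrightarrow> \<Phi> (b, a) \<in> Hom Q (ty A a) (ty B b)"
    and "\<lbrakk>b' \<in> Objs B; b \<in> Objs B; a \<in> Objs A\<rbrakk> \<Longrightarrow> hom B b' b \<cdot>\<^bsub>Q\<^esub> \<Phi> (b, a) \<sqsubseteq>\<^bsub>Q\<^esub> \<Phi> (b', a)"
    and "\<lbrakk>b \<in> Objs B; a \<in> Objs A; a' \<in> Objs A\<rbrakk> \<Longrightarrow> \<Phi> (b, a) \<cdot>\<^bsub>Q\<^esub> hom A a a' \<sqsubseteq>\<^bsub>Q\<^esub> \<Phi> (b, a')"
  using assms by (auto simp: distributor_def)

lemma q_functorD:
  assumes "q_functor Q A B F"
  shows "F \<in> Objs A \<rightarrow>\<^sub>E Objs B"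
    and "a \<in> Objs A \<Longrightarrow> F a \<in> Objs B"
    and "a \<in> Objs A \<Longrightarrow> ty B (F a) = ty A a"
    and "\<lbrakk>a' \<in> Objs A; a \<in> Objs A\<rbrakk> \<Longrightarrow> hom A a' a \<sqsubseteq>\<^bsub>Q\<^esub> hom B (F a') (F a)"
  using assms by (auto simp: q_functor_def)

lemma distributor_eqI:
  assumes "distributor Q A B \<Phi>" "distributor Q A B \<Psi>"
    "\<And>b a. \<lbrakk>b \<in> Objs B; a \<in> Objs A\<rbrakk> \<Longrightarrow> \<Phi> (b, a) = \<Psi> (b, a)"
  shows "\<Phi> = \<Psi>"
  by (rule extensionalityI[of _ "Objs B \<times> Objs A"]) (use assms in \<open>auto simp: distributor_def\<close>)

context quantaloid
begin

lemma dist_le_refl: "distributor Q A B \<Phi> \<Longrightarrow> dist_le Q A B \<Phi> \<Phi>"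
  unfolding dist_le_def using distributorD(2) leq_refl by fast

lemma dist_le_trans:
  assumes "dist_le Q A B \<Phi> \<Psi>" "dist_le Q A B \<Psi> \<Xi>"
    "distributor Q A B \<Phi>" "distributor Q A B \<Psi>" "distributor Q A B \<Xi>"
  shows "dist_le Q A B \<Phi> \<Xi>"
  unfolding dist_le_def
proof (intro ballI)
  fix b a assume "b \<in> Objs B" "a \<in> Objs A"
  then show "\<Phi> (b, a) \<sqsubseteq> \<Xi> (b, a)"
    using assms(1,2) distributorD(2)[OF assms(3)] distributorD(2)[OF assms(4)]
      distributorD(2)[OF assms(5)] leq_trans unfolding dist_le_def by blast
qed

lemma dist_le_antisym:
  assumes "dist_le Q A B \<Phi> \<Psi>" "dist_le Q A B \<Psi> \<Phi>" "distributor Q A B \<Phi>" "distributor Q A B \<Psi>"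
  shows "\<Phi> = \<Psi>"
proof (rule distributor_eqI[OF assms(3,4)])
  fix b a assume "b \<in> Objs B" "a \<in> Objs A"
  then show "\<Phi> (b, a) = \<Psi> (b, a)"
    using assms(1,2) distributorD(2)[OF assms(3)] distributorD(2)[OF assms(4)]
      leq_antisym unfolding dist_le_def by blast
qed

lemma distributor_dist_id:
  assumes "q_category Q A"
  shows "distributor Q A A (dist_id A)"
  using q_categoryD[OF assms] by (auto simp: distributor_def dist_id_def)

lemma dist_comp_apply:
  "\<lbrakk>c \<in> Objs C; a \<in> Objs A\<rbrakk> \<Longrightarrow> dist_comp Q A B C \<Psi> \<Phi> (c, a)
    = Join Q (ty A a) (ty C c) ((\<lambda>b. \<Psi> (c, b) \<cdot> \<Phi> (b, a)) ` Objs B)"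
  by (simp add: dist_comp_def)

context
  fixes A :: "('o, 'm, 'a) qcat" and B :: "('o, 'm, 'b) qcat" and C :: "('o, 'm, 'c) qcat"
    and \<Phi> \<Psi>
  assumes A: "q_category Q A" and B: "q_category Q B" and C: "q_category Q C"
    and \<Phi>: "distributor Q A B \<Phi>" and \<Psi>: "distributor Q B C \<Psi>"
begin

lemma dist_comp_term_closed:
  "\<lbrakk>c \<in> Objs C; b \<in> Objs B; a \<in> Objs A\<rbrakk> \<Longrightarrow> \<Psi> (c, b) \<cdot> \<Phi> (b, a) \<in> Hom Q (ty A a) (ty C c)"
  using distributorD(2)[OF \<Phi>] distributorD(2)[OF \<Psi>] comp_closed by blast

lemma dist_comp_closed:
  "\<lbrakk>c \<in> Objs C; a \<in> Objs A\<rbrakk> \<Longrightarrow> dist_comp Q A B C \<Psi> \<Phi> (c, a) \<in> Hom Q (ty A a) (ty C c)"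
  using dist_comp_term_closed q_categoryD(1)[OF A] q_categoryD(1)[OF C]
  by (auto simp: dist_comp_apply intro!: Join_closed)

lemma dist_comp_upper:
  "\<lbrakk>c \<in> Objs C; b \<in> Objs B; a \<in> Objs A\<rbrakk> \<Longrightarrow> \<Psi> (c, b) \<cdot> \<Phi> (b, a) \<sqsubseteq> dist_comp Q A B C \<Psi> \<Phi> (c, a)"
  using dist_comp_term_closed q_categoryD(1)[OF A] q_categoryD(1)[OF C]
  by (auto simp: dist_comp_apply intro!: Join_upper)

lemma dist_comp_le_iff:
  assumes "c \<in> Objs C" "a \<in> Objs A" "x \<in> Hom Q (ty A a) (ty C c)"
  shows "dist_comp Q A B C \<Psi> \<Phi> (c, a) \<sqsubseteq> x \<longleftrightarrow> (\<forall>b\<in>Objs B. \<Psi> (c, b) \<cdot> \<Phi> (b, a) \<sqsubseteq> x)"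
proof -
  have "(\<lambda>b. \<Psi> (c, b) \<cdot> \<Phi> (b, a)) ` Objs B \<subseteq> Hom Q (ty A a) (ty C c)"
    using assms dist_comp_term_closed by blast
  then show ?thesis
    using assms q_categoryD(1)[OF A] q_categoryD(1)[OF C]
    by (auto simp: dist_comp_apply Join_le_iff)
qed

lemma comp_dist_comp_le_iff:
  assumes "c \<in> Objs C" "a \<in> Objs A" "g \<in> Hom Q (ty C c) D" "x \<in> Hom Q (ty A a) D"
  shows "g \<cdot> dist_comp Q A B C \<Psi> \<Phi> (c, a) \<sqsubseteq> x
    \<longleftrightarrow> (\<forall>b\<in>Objs B. g \<cdot> (\<Psi> (c, b) \<cdot> \<Phi> (b, a)) \<sqsubseteq> x)"
proof -
  have "(\<lambda>b. \<Psi> (c, b) \<cdot> \<Phi> (b, a)) ` Objs B \<subseteq> Hom Q (ty A a) (ty C c)"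
    using assms dist_comp_term_closed by blast
  then show ?thesis
    using assms q_categoryD(1)[OF A]
    by (auto simp: dist_comp_apply comp_Join_le_iff)
qed

lemma dist_comp_comp_le_iff:
  assumes "c \<in> Objs C" "a \<in> Objs A" "f \<in> Hom Q D (ty A a)" "x \<in> Hom Q D (ty C c)"
  shows "dist_comp Q A B C \<Psi> \<Phi> (c, a) \<cdot> f \<sqsubseteq> x
    \<longleftrightarrow> (\<forall>b\<in>Objs B. \<Psi> (c, b) \<cdot> \<Phi> (b, a) \<cdot> f \<sqsubseteq> x)"
proof -
  have "(\<lambda>b. \<Psi> (c, b) \<cdot> \<Phi> (b, a)) ` Objs B \<subseteq> Hom Q (ty A a) (ty C c)"
    using assms dist_comp_term_closed by blast
  then show ?thesis
    using assms q_categoryD(1)[OF C]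
    by (auto simp: dist_comp_apply Join_comp_le_iff)
qed

lemma distributor_dist_comp: "distributor Q A C (dist_comp Q A B C \<Psi> \<Phi>)"
  unfolding distributor_def
proof (intro conjI ballI)
  show "dist_comp Q A B C \<Psi> \<Phi> \<in> extensional (Objs C \<times> Objs A)"
    by (simp add: dist_comp_def)
next
  fix c a assume "c \<in> Objs C" "a \<in> Objs A"
  then show "dist_comp Q A B C \<Psi> \<Phi> (c, a) \<in> Hom Q (ty A a) (ty C c)" by (rule dist_comp_closed)
next
  fix c' c a assume in_objs: "c' \<in> Objs C" "c \<in> Objs C" "a \<in> Objs A"
  have "hom C c' c \<cdot> (\<Psi> (c, b) \<cdot> \<Phi> (b, a)) \<sqsubseteq> dist_comp Q A B C \<Psi> \<Phi> (c', a)" if b: "b \<in> Objs B" for b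
  proof (rule leq_trans)
    note mem = distributorD(2)[OF \<Phi>] distributorD(2)[OF \<Psi>] q_categoryD(2)[OF C]
    have "hom C c' c \<cdot> (\<Psi> (c, b) \<cdot> \<Phi> (b, a)) = (hom C c' c \<cdot> \<Psi> (c, b)) \<cdot> \<Phi> (b, a)"
      using in_objs b mem comp_assoc by metis
    also have "\<dots> \<sqsubseteq> \<Psi> (c', b) \<cdot> \<Phi> (b, a)"
      using in_objs b mem distributorD(3)[OF \<Psi>] comp_closed by (blast intro: comp_mono_left)
    finally show "hom C c' c \<cdot> (\<Psi> (c, b) \<cdot> \<Phi> (b, a)) \<sqsubseteq> \<Psi> (c', b) \<cdot> \<Phi> (b, a)" .
  qed (use in_objs b dist_comp_upper dist_comp_term_closed dist_comp_closed q_categoryD(2)[OF C]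
         comp_closed in \<open>blast+\<close>)
  then show "hom C c' c \<cdot> dist_comp Q A B C \<Psi> \<Phi> (c, a) \<sqsubseteq> dist_comp Q A B C \<Psi> \<Phi> (c', a)"
    using comp_dist_comp_le_iff[OF in_objs(2,3) q_categoryD(2)[OF C in_objs(1,2)]
        dist_comp_closed[OF in_objs(1,3)]] by blast
next
  fix c a a' assume in_objs: "c \<in> Objs C" "a \<in> Objs A" "a' \<in> Objs A"
  have "\<Psi> (c, b) \<cdot> \<Phi> (b, a) \<cdot> hom A a a' \<sqsubseteq> dist_comp Q A B C \<Psi> \<Phi> (c, a')" if b: "b \<in> Objs B" for b
  proof (rule leq_trans)
    note mem = distributorD(2)[OF \<Phi>] distributorD(2)[OF \<Psi>] q_categoryD(2)[OF A]
    have "\<Psi> (c, b) \<cdot> \<Phi> (b, a) \<cdot> hom A a a' = \<Psi> (c, b) \<cdot> (\<Phi> (b, a) \<cdot> hom A a a')"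
      using in_objs b mem comp_assoc by metis
    also have "\<dots> \<sqsubseteq> \<Psi> (c, b) \<cdot> \<Phi> (b, a')"
      using in_objs b mem distributorD(4)[OF \<Phi>] comp_closed by (blast intro: comp_mono_right)
    finally show "\<Psi> (c, b) \<cdot> \<Phi> (b, a) \<cdot> hom A a a' \<sqsubseteq> \<Psi> (c, b) \<cdot> \<Phi> (b, a')" .
  qed (use in_objs b dist_comp_upper dist_comp_term_closed dist_comp_closed q_categoryD(2)[OF A]
         comp_closed in \<open>blast+\<close>)
  then show "dist_comp Q A B C \<Psi> \<Phi> (c, a) \<cdot> hom A a a' \<sqsubseteq> dist_comp Q A B C \<Psi> \<Phi> (c, a')"
    using dist_comp_comp_le_iff[OF in_objs(1,2) q_categoryD(2)[OF A in_objs(2,3)]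
        dist_comp_closed[OF in_objs(1,3)]] by blast
qed

end

lemma dist_comp_assoc:
  assumes A: "q_category Q A" and B: "q_category Q B" and C: "q_category Q C" and D: "q_category Q D"
    and \<Phi>: "distributor Q A B \<Phi>" and \<Psi>: "distributor Q B C \<Psi>" and \<Xi>: "distributor Q C D \<Xi>"
  shows "dist_comp Q A C D \<Xi> (dist_comp Q A B C \<Psi> \<Phi>) = dist_comp Q A B D (dist_comp Q B C D \<Xi> \<Psi>) \<Phi>"
proof (rule distributor_eqI)
  have \<Psi>\<Phi>: "distributor Q A C (dist_comp Q A B C \<Psi> \<Phi>)" by (rule distributor_dist_comp) fact+
  have \<Xi>\<Psi>: "distributor Q B D (dist_comp Q B C D \<Xi> \<Psi>)" by (rule distributor_dist_comp) fact+
  show l: "distributor Q A D (dist_comp Q A C D \<Xi> (dist_comp Q A B C \<Psi> \<Phi>))"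
    by (rule distributor_dist_comp) fact+
  show r: "distributor Q A D (dist_comp Q A B D (dist_comp Q B C D \<Xi> \<Psi>) \<Phi>)"
    by (rule distributor_dist_comp) fact+
  fix d a assume da: "d \<in> Objs D" "a \<in> Objs A"
  note mem = distributorD(2)[OF \<Phi>] distributorD(2)[OF \<Psi>] distributorD(2)[OF \<Xi>]
  show "dist_comp Q A C D \<Xi> (dist_comp Q A B C \<Psi> \<Phi>) (d, a)
      = dist_comp Q A B D (dist_comp Q B C D \<Xi> \<Psi>) \<Phi> (d, a)"
  proof (rule eq_by_upper_bounds[OF distributorD(2)[OF l da] distributorD(2)[OF r da]])
    fix x assume x: "x \<in> Hom Q (ty A a) (ty D d)"
    have "dist_comp Q A C D \<Xi> (dist_comp Q A B C \<Psi> \<Phi>) (d, a) \<sqsubseteq> x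
        \<longleftrightarrow> (\<forall>c\<in>Objs C. \<forall>b\<in>Objs B. \<Xi> (d, c) \<cdot> (\<Psi> (c, b) \<cdot> \<Phi> (b, a)) \<sqsubseteq> x)"
      using comp_dist_comp_le_iff[OF A B C \<Phi> \<Psi> _ da(2) mem(3)[OF da(1)] x]
      by (simp add: dist_comp_le_iff[OF A C D \<Psi>\<Phi> \<Xi> da x])
    also have "\<dots> \<longleftrightarrow> (\<forall>b\<in>Objs B. \<forall>c\<in>Objs C. \<Xi> (d, c) \<cdot> \<Psi> (c, b) \<cdot> \<Phi> (b, a) \<sqsubseteq> x)"
      using comp_assoc[OF mem(3) mem(2) mem(1)] da by fastforce
    also have "\<dots> \<longleftrightarrow> dist_comp Q A B D (dist_comp Q B C D \<Xi> \<Psi>) \<Phi> (d, a) \<sqsubseteq> x"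
      using dist_comp_comp_le_iff[OF B C D \<Psi> \<Xi> da(1) _ mem(1)[OF _ da(2)] x]
      by (simp add: dist_comp_le_iff[OF A B D \<Phi> \<Xi>\<Psi> da x])
    finally show "dist_comp Q A C D \<Xi> (dist_comp Q A B C \<Psi> \<Phi>) (d, a) \<sqsubseteq> x
        \<longleftrightarrow> dist_comp Q A B D (dist_comp Q B C D \<Xi> \<Psi>) \<Phi> (d, a) \<sqsubseteq> x" .
  qed
qed

lemma dist_comp_mono:
  assumes A: "q_category Q A" and B: "q_category Q B" and C: "q_category Q C"
    and \<Phi>: "distributor Q A B \<Phi>" "distributor Q A B \<Phi>'" "dist_le Q A B \<Phi> \<Phi>'"
    and \<Psi>: "distributor Q B C \<Psi>" "distributor Q B C \<Psi>'" "dist_le Q B C \<Psi> \<Psi>'"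
  shows "dist_le Q A C (dist_comp Q A B C \<Psi> \<Phi>) (dist_comp Q A B C \<Psi>' \<Phi>')"
  unfolding dist_le_def
proof (intro ballI)
  fix c a assume ca: "c \<in> Objs C" "a \<in> Objs A"
  have "\<Psi> (c, b) \<cdot> \<Phi> (b, a) \<sqsubseteq> dist_comp Q A B C \<Psi>' \<Phi>' (c, a)" if b: "b \<in> Objs B" for b
  proof (rule leq_trans)
    show "\<Psi> (c, b) \<cdot> \<Phi> (b, a) \<sqsubseteq> \<Psi>' (c, b) \<cdot> \<Phi>' (b, a)"
      using \<Phi>(3) \<Psi>(3) ca b unfolding dist_le_def
      by (intro comp_mono[of _ _ _ _ "ty B b" "ty C c" "ty A a"] distributorD(2)[OF \<Phi>(1)]
          distributorD(2)[OF \<Phi>(2)] distributorD(2)[OF \<Psi>(1)] distributorD(2)[OF \<Psi>(2)]) simp_all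
    show "\<Psi>' (c, b) \<cdot> \<Phi>' (b, a) \<sqsubseteq> dist_comp Q A B C \<Psi>' \<Phi>' (c, a)"
      using dist_comp_upper[OF A B C \<Phi>(2) \<Psi>(2)] ca b by blast
  qed (rule ca b dist_comp_term_closed[OF A B C \<Phi>(1) \<Psi>(1)]
        dist_comp_term_closed[OF A B C \<Phi>(2) \<Psi>(2)] dist_comp_closed[OF A B C \<Phi>(2) \<Psi>(2)])+
  then show "dist_comp Q A B C \<Psi> \<Phi> (c, a) \<sqsubseteq> dist_comp Q A B C \<Psi>' \<Phi>' (c, a)"
    using ca dist_comp_closed[OF A B C \<Phi>(2) \<Psi>(2)] by (simp add: dist_comp_le_iff[OF A B C \<Phi>(1) \<Psi>(1)])
qed

section \<open>Functors as distributors\<close>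

text \<open>The right adjoint \<open>B(F-,-)\<close> of \<open>B(-,F-)\<close>.\<close>

definition functor_codist ::
  "('o, 'm, 'a) qcat \<Rightarrow> ('o, 'm, 'b) qcat \<Rightarrow> ('a \<Rightarrow> 'b) \<Rightarrow> ('a \<times> 'b \<Rightarrow> 'm)" where
  "functor_codist A B F = (\<lambda>(a, b)\<in>Objs A \<times> Objs B. hom B (F a) b)"

lemma hom_functor_closed:
  assumes A: "q_category Q A" and B: "q_category Q B" and F: "q_functor Q A B F"
  shows "\<lbrakk>b \<in> Objs B; a \<in> Objs A\<rbrakk> \<Longrightarrow> hom B b (F a) \<in> Hom Q (ty A a) (ty B b)"
    and "\<lbrakk>b \<in> Objs B; a \<in> Objs A\<rbrakk> \<Longrightarrow> hom B (F a) b \<in> Hom Q (ty B b) (ty A a)"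
    and "\<lbrakk>a' \<in> Objs A; a \<in> Objs A\<rbrakk> \<Longrightarrow> hom B (F a') (F a) \<in> Hom Q (ty A a) (ty A a')"
  using q_functorD[OF F] q_categoryD(2)[OF B] by metis+

lemma distributor_functor_dist:
  assumes A: "q_category Q A" and B: "q_category Q B" and F: "q_functor Q A B F"
  shows "distributor Q A B (functor_dist A B F)"
proof -
  note F' = q_functorD[OF F] and mem = hom_functor_closed[OF A B F] and hA = q_categoryD(2)[OF A]
  have "hom B b (F a) \<cdot> hom A a a' \<sqsubseteq> hom B b (F a')"
    if b: "b \<in> Objs B" and a: "a \<in> Objs A" and a': "a' \<in> Objs A" for b a a'
  proof (rule leq_trans)
    show "hom B b (F a) \<cdot> hom A a a' \<sqsubseteq> hom B b (F a) \<cdot> hom B (F a) (F a')"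
      by (rule comp_mono_right[OF F'(4)[OF a a'] hA[OF a a'] mem(3)[OF a a'] mem(1)[OF b a]])
    show "hom B b (F a) \<cdot> hom B (F a) (F a') \<sqsubseteq> hom B b (F a')"
      by (rule q_categoryD(3)[OF B b F'(2)[OF a] F'(2)[OF a']])
  qed (rule comp_closed[OF mem(1)[OF b a]] hA[OF a a'] mem(3)[OF a a'] mem(1)[OF b a'])+
  then show ?thesis
    using F'(2) mem(1) q_categoryD(3)[OF B] by (simp add: distributor_def functor_dist_def)
qed

lemma distributor_functor_codist:
  assumes A: "q_category Q A" and B: "q_category Q B" and F: "q_functor Q A B F"
  shows "distributor Q B A (functor_codist A B F)"
proof -
  note F' = q_functorD[OF F] and mem = hom_functor_closed[OF A B F] and hA = q_categoryD(2)[OF A]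
  have "hom A a' a \<cdot> hom B (F a) b \<sqsubseteq> hom B (F a') b"
    if b: "b \<in> Objs B" and a: "a \<in> Objs A" and a': "a' \<in> Objs A" for b a a'
  proof (rule leq_trans)
    show "hom A a' a \<cdot> hom B (F a) b \<sqsubseteq> hom B (F a') (F a) \<cdot> hom B (F a) b"
      by (rule comp_mono_left[OF F'(4)[OF a' a] hA[OF a' a] mem(3)[OF a' a] mem(2)[OF b a]])
    show "hom B (F a') (F a) \<cdot> hom B (F a) b \<sqsubseteq> hom B (F a') b"
      by (rule q_categoryD(3)[OF B F'(2)[OF a'] F'(2)[OF a] b])
  qed (rule comp_closed[OF _ mem(2)[OF b a]] hA[OF a' a] mem(3)[OF a' a] mem(2)[OF b a'])+
  then show ?thesis
    using F'(2) mem(2) q_categoryD(3)[OF B] by (simp add: distributor_def functor_codist_def)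
qed

text \<open>The two Yoneda-type equations. The supremum over \<open>b'\<close> of \<open>X(c,b') \<cdot> B(b',Fa)\<close> is bounded by
  \<open>X(c,Fa)\<close> because \<open>X\<close> is a distributor, and its term at \<open>b' = Fa\<close> reaches this bound because
  \<open>B(Fa,Fa)\<close> contains the identity. The second equation is dual.\<close>

lemma dist_comp_functor_dist:
  assumes A: "q_category Q A" and B: "q_category Q B" and C: "q_category Q C"
    and F: "q_functor Q A B F" and X: "distributor Q B C X" and ca: "c \<in> Objs C" "a \<in> Objs A"
  shows "dist_comp Q A B C X (functor_dist A B F) (c, a) = X (c, F a)"
proof -
  note Fd = distributor_functor_dist[OF A B F]
  have Fa: "F a \<in> Objs B" "ty B (F a) = ty A a" using q_functorD[OF F] ca by auto
  have X_mem: "X (c, F a) \<in> Hom Q (ty A a) (ty C c)" using distributorD(2)[OF X ca(1) Fa(1)] Fa by simp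
  show ?thesis
  proof (rule leq_antisym[OF _ _ dist_comp_closed[OF A B C Fd X ca] X_mem])
    show "dist_comp Q A B C X (functor_dist A B F) (c, a) \<sqsubseteq> X (c, F a)"
      using ca Fa distributorD(4)[OF X] X_mem
      by (simp add: dist_comp_le_iff[OF A B C Fd X]) (simp add: functor_dist_def)
    have "X (c, F a) = X (c, F a) \<cdot> Ident Q (ty A a)" using X_mem comp_ident_right by simp
    also have "\<dots> \<sqsubseteq> X (c, F a) \<cdot> functor_dist A B F (F a, a)"
      using X_mem q_categoryD(4)[OF B Fa(1)] Fa ca distributorD(2)[OF Fd Fa(1) ca(2)] ident_closed
        q_categoryD(1)[OF A ca(2)]
      by (intro comp_mono_right) (auto simp: functor_dist_def)
    finally show "X (c, F a) \<sqsubseteq> dist_comp Q A B C X (functor_dist A B F) (c, a)"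
      by (rule leq_trans[OF _ dist_comp_upper[OF A B C Fd X ca(1) Fa(1) ca(2)] X_mem
            dist_comp_term_closed[OF A B C Fd X ca(1) Fa(1) ca(2)]
            dist_comp_closed[OF A B C Fd X ca]])
  qed
qed

lemma functor_codist_dist_comp:
  assumes A: "q_category Q A" and B: "q_category Q B" and C: "q_category Q C"
    and F: "q_functor Q C B F" and X: "distributor Q A B X" and ca: "c \<in> Objs C" "a \<in> Objs A"
  shows "dist_comp Q A B C (functor_codist C B F) X (c, a) = X (F c, a)"
proof -
  note Fd = distributor_functor_codist[OF C B F]
  have Fc: "F c \<in> Objs B" "ty B (F c) = ty C c" using q_functorD[OF F] ca by auto
  have X_mem: "X (F c, a) \<in> Hom Q (ty A a) (ty C c)" using distributorD(2)[OF X Fc(1) ca(2)] Fc by simp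
  show ?thesis
  proof (rule leq_antisym[OF _ _ dist_comp_closed[OF A B C X Fd ca] X_mem])
    show "dist_comp Q A B C (functor_codist C B F) X (c, a) \<sqsubseteq> X (F c, a)"
      using ca Fc distributorD(3)[OF X] X_mem
      by (simp add: dist_comp_le_iff[OF A B C X Fd]) (simp add: functor_codist_def)
    have "X (F c, a) = Ident Q (ty C c) \<cdot> X (F c, a)" using X_mem comp_ident_left by simp
    also have "\<dots> \<sqsubseteq> functor_codist C B F (c, F c) \<cdot> X (F c, a)"
      using X_mem q_categoryD(4)[OF B Fc(1)] Fc ca distributorD(2)[OF Fd ca(1) Fc(1)] ident_closed
        q_categoryD(1)[OF C ca(1)]
      by (intro comp_mono_left) (auto simp: functor_codist_def)
    finally show "X (F c, a) \<sqsubseteq> dist_comp Q A B C (functor_codist C B F) X (c, a)"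
      by (rule leq_trans[OF _ dist_comp_upper[OF A B C X Fd ca(1) Fc(1) ca(2)] X_mem
            dist_comp_term_closed[OF A B C X Fd ca(1) Fc(1) ca(2)]
            dist_comp_closed[OF A B C X Fd ca]])
  qed
qed

lemma q_functor_id: "q_category Q A \<Longrightarrow> q_functor Q A A (functor_id A)"
  by (auto simp: q_functor_def functor_id_def intro!: leq_refl q_categoryD(2))

lemma functor_dist_id: "functor_dist A A (functor_id A) = dist_id A"
  and functor_codist_id: "functor_codist A A (functor_id A) = dist_id A"
  by (auto simp: functor_dist_def functor_codist_def dist_id_def functor_id_def fun_eq_iff)

lemma dist_comp_id_right:
  assumes "q_category Q A" "q_category Q B" "distributor Q A B X"
  shows "dist_comp Q A A B X (dist_id A) = X"
  by (rule distributor_eqI[OF distributor_dist_comp])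
    (use assms distributor_dist_id dist_comp_functor_dist[OF assms(1,1,2) q_functor_id assms(3)]
      in \<open>auto simp: functor_dist_id, auto simp: functor_id_def\<close>)

lemma dist_comp_id_left:
  assumes "q_category Q A" "q_category Q B" "distributor Q A B X"
  shows "dist_comp Q A B B (dist_id B) X = X"
  by (rule distributor_eqI[OF distributor_dist_comp])
    (use assms distributor_dist_id functor_codist_dist_comp[OF assms(1,2,2) q_functor_id assms(3)]
      in \<open>auto simp: functor_codist_id, auto simp: functor_id_def\<close>)

lemma functor_dist_functor_comp:
  assumes A: "q_category Q A" and B: "q_category Q B" and C: "q_category Q C"
    and F: "q_functor Q A B F" and G: "q_functor Q B C G"
  shows "functor_dist A C (functor_comp A G F)
    = dist_comp Q A B C (functor_dist B C G) (functor_dist A B F)"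
proof (rule extensionalityI[of _ "Objs C \<times> Objs A"])
  fix p assume "p \<in> Objs C \<times> Objs A"
  then show "functor_dist A C (functor_comp A G F) p
      = dist_comp Q A B C (functor_dist B C G) (functor_dist A B F) p"
    using dist_comp_functor_dist[OF A B C F distributor_functor_dist[OF B C G]] q_functorD(2)[OF F]
    by (auto simp: functor_dist_def functor_comp_def compose_def)
qed (auto simp: functor_dist_def dist_comp_def)

lemma functor_dist_left_adjoint:
  assumes A: "q_category Q A" and B: "q_category Q B" and F: "q_functor Q A B F"
  shows "dist_left_adjoint Q A B (functor_dist A B F) (functor_codist A B F)"
  unfolding dist_left_adjoint_def
proof (intro conjI)
  note l = distributor_functor_dist[OF A B F] and r = distributor_functor_codist[OF A B F]
  show "distributor Q A B (functor_dist A B F)" by (rule l)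
  show "distributor Q B A (functor_codist A B F)" by (rule r)
  show "dist_le Q A A (dist_id A) (dist_comp Q A B A (functor_codist A B F) (functor_dist A B F))"
    using dist_comp_functor_dist[OF A B A F r] q_functorD[OF F]
    by (auto simp: dist_le_def dist_id_def functor_codist_def)
  show "dist_le Q B B (dist_comp Q B A B (functor_dist A B F) (functor_codist A B F)) (dist_id B)"
    unfolding dist_le_def
  proof (intro ballI)
    fix b b' assume b: "b \<in> Objs B" "b' \<in> Objs B"
    have "functor_dist A B F (b, a) \<cdot> functor_codist A B F (a, b') \<sqsubseteq> hom B b b'" if "a \<in> Objs A" for a
      using that b q_categoryD(3)[OF B] q_functorD(2)[OF F]
      by (simp add: functor_dist_def functor_codist_def)
    then show "dist_comp Q B A B (functor_dist A B F) (functor_codist A B F) (b, b')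
        \<sqsubseteq> dist_id B (b, b')"
      using b dist_comp_le_iff[OF B A B r l b q_categoryD(2)[OF B b]] by (simp add: dist_id_def)
  qed
qed

text \<open>Both directions are read off at a single element: \<open>F \<le> G\<close> gives \<open>B(b,Fa) \<cdot> 1 \<sqsubseteq> B(b,Ga)\<close> by
  composing with \<open>1 \<sqsubseteq> B(Fa,Ga)\<close>, and conversely \<open>1 \<sqsubseteq> B(Fa,Fa) \<sqsubseteq> B(Fa,Ga)\<close>.\<close>

lemma functor_le_iff_dist_le:
  assumes A: "q_category Q A" and B: "q_category Q B"
    and F: "q_functor Q A B F" and G: "q_functor Q A B G"
  shows "functor_le Q A B F G \<longleftrightarrow> dist_le Q A B (functor_dist A B F) (functor_dist A B G)"
proof
  note F' = q_functorD[OF F] and G' = q_functorD[OF G]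
  assume le: "functor_le Q A B F G"
  show "dist_le Q A B (functor_dist A B F) (functor_dist A B G)"
    unfolding dist_le_def
  proof (intro ballI)
    fix b a assume ba: "b \<in> Objs B" "a \<in> Objs A"
    have mem: "hom B b (F a) \<in> Hom Q (ty A a) (ty B b)" "hom B b (G a) \<in> Hom Q (ty A a) (ty B b)"
      "hom B (F a) (G a) \<in> Hom Q (ty A a) (ty A a)"
      using ba hom_functor_closed(1)[OF A B F] hom_functor_closed(1)[OF A B G] F'(2,3) by fastforce+
    have "hom B b (F a) = hom B b (F a) \<cdot> Ident Q (ty A a)" using mem comp_ident_right by simp
    also have "\<dots> \<sqsubseteq> hom B b (F a) \<cdot> hom B (F a) (G a)"
      by (rule comp_mono_right[OF _ ident_closed mem(3,1)])
        (use le ba q_categoryD(1)[OF A] in \<open>auto simp: functor_le_def\<close>)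
    finally have "hom B b (F a) \<sqsubseteq> hom B b (G a)"
      by (rule leq_trans[OF _ q_categoryD(3)[OF B ba(1) F'(2)[OF ba(2)] G'(2)[OF ba(2)]]
            mem(1) comp_closed[OF mem(1,3)] mem(2)])
    then show "functor_dist A B F (b, a) \<sqsubseteq> functor_dist A B G (b, a)"
      using ba by (simp add: functor_dist_def)
  qed
next
  note F' = q_functorD[OF F]
  assume le: "dist_le Q A B (functor_dist A B F) (functor_dist A B G)"
  show "functor_le Q A B F G"
    unfolding functor_le_def
  proof
    fix a assume a: "a \<in> Objs A"
    have "Ident Q (ty A a) \<sqsubseteq> hom B (F a) (F a)"
      using q_categoryD(4)[OF B F'(2)[OF a]] F'(3)[OF a] by simp
    moreover have "hom B (F a) (F a) \<sqsubseteq> hom B (F a) (G a)"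
      using le a F' by (auto simp: dist_le_def functor_dist_def)
    moreover have "hom B (F a) (F a) \<in> Hom Q (ty A a) (ty A a)"
      "hom B (F a) (G a) \<in> Hom Q (ty A a) (ty A a)"
      using hom_functor_closed(3)[OF A B F a a] hom_functor_closed(1)[OF A B G F'(2)[OF a] a]
        F'(3)[OF a] by simp_all
    ultimately show "Ident Q (ty A a) \<sqsubseteq> hom B (F a) (G a)"
      by (rule leq_trans[OF _ _ ident_closed[OF q_categoryD(1)[OF A a]]])
  qed
qed

text \<open>A map that represents a distributor objectwise is automatically functorial:
  \<open>A(a',a) \<sqsubseteq> B(Fa',Fa') \<cdot> A(a',a) = \<Phi>(Fa',a') \<cdot> A(a',a) \<sqsubseteq> \<Phi>(Fa',a) = B(Fa',Fa)\<close>.\<close>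

lemma representing_map_is_functor:
  assumes A: "q_category Q A" and B: "q_category Q B" and \<Phi>: "distributor Q A B \<Phi>"
    and F: "F \<in> Objs A \<rightarrow>\<^sub>E Objs B" and ty: "\<And>a. a \<in> Objs A \<Longrightarrow> ty B (F a) = ty A a"
    and rep: "\<And>b a. \<lbrakk>b \<in> Objs B; a \<in> Objs A\<rbrakk> \<Longrightarrow> \<Phi> (b, a) = hom B b (F a)"
  shows "q_functor Q A B F" and "functor_dist A B F = \<Phi>"
proof -
  have "hom A a' a \<sqsubseteq> hom B (F a') (F a)" if aa: "a' \<in> Objs A" "a \<in> Objs A" for a' a
  proof -
    have F_mem: "F a' \<in> Objs B" "F a \<in> Objs B" using F aa by auto
    have mem: "hom A a' a \<in> Hom Q (ty A a) (ty A a')" "hom B (F a') (F a) \<in> Hom Q (ty A a) (ty A a')"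
      "hom B (F a') (F a') \<in> Hom Q (ty A a') (ty A a')"
      using aa F_mem q_categoryD(2)[OF A] q_categoryD(2)[OF B] ty by metis+
    have "hom A a' a = Ident Q (ty A a') \<cdot> hom A a' a" using mem comp_ident_left by simp
    also have "\<dots> \<sqsubseteq> hom B (F a') (F a') \<cdot> hom A a' a"
      using aa mem q_categoryD(4)[OF B F_mem(1)] ty ident_closed q_categoryD(1)[OF A]
      by (intro comp_mono_left) auto
    finally show ?thesis
      by (rule leq_trans[OF _ _ mem(1) comp_closed[OF mem(3,1)] mem(2)])
        (use distributorD(4)[OF \<Phi>] rep F_mem aa in metis)
  qed
  then show "q_functor Q A B F" using F ty by (auto simp: q_functor_def)
  show "functor_dist A B F = \<Phi>"
    by (rule extensionalityI[of _ "Objs B \<times> Objs A"])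
      (use distributorD(1)[OF \<Phi>] rep in \<open>auto simp: functor_dist_def\<close>)
qed

section \<open>Cauchy distributors\<close>

lemma dist_left_adjointD:
  assumes "dist_left_adjoint Q A B \<Phi> \<Psi>"
  shows "distributor Q A B \<Phi>" "distributor Q B A \<Psi>"
    "dist_le Q A A (dist_id A) (dist_comp Q A B A \<Psi> \<Phi>)"
    "dist_le Q B B (dist_comp Q B A B \<Phi> \<Psi>) (dist_id B)"
  using assms by (auto simp: dist_left_adjoint_def)

lemma left_adjoint_counit_le:
  assumes A: "q_category Q A" and B: "q_category Q B" and C: "q_category Q C"
    and adj: "dist_left_adjoint Q B C \<Psi> \<Psi>'" and \<Phi>: "distributor Q A C \<Phi>"
  shows "dist_le Q A C (dist_comp Q A B C \<Psi> (dist_comp Q A C B \<Psi>' \<Phi>)) \<Phi>"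
proof -
  note adj' = dist_left_adjointD[OF adj]
  have "dist_comp Q A B C \<Psi> (dist_comp Q A C B \<Psi>' \<Phi>) = dist_comp Q A C C (dist_comp Q C B C \<Psi> \<Psi>') \<Phi>"
    by (rule dist_comp_assoc[OF A C B C \<Phi> adj'(2,1)])
  moreover have "dist_le Q A C (dist_comp Q A C C (dist_comp Q C B C \<Psi> \<Psi>') \<Phi>)
      (dist_comp Q A C C (dist_id C) \<Phi>)"
    by (rule dist_comp_mono[OF A C C \<Phi> \<Phi> dist_le_refl[OF \<Phi>]
          distributor_dist_comp[OF C B C adj'(2,1)] distributor_dist_id[OF C] adj'(4)])
  ultimately show ?thesis by (simp add: dist_comp_id_left[OF A C \<Phi>])
qed

lemma left_adjoint_unit_le:
  assumes A: "q_category Q A" and B: "q_category Q B" and C: "q_category Q C"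
    and adj: "dist_left_adjoint Q B C \<Psi> \<Psi>'" and \<Phi>: "distributor Q A B \<Phi>"
  shows "dist_le Q A B \<Phi> (dist_comp Q A C B \<Psi>' (dist_comp Q A B C \<Psi> \<Phi>))"
proof -
  note adj' = dist_left_adjointD[OF adj]
  have "dist_comp Q A C B \<Psi>' (dist_comp Q A B C \<Psi> \<Phi>) = dist_comp Q A B B (dist_comp Q B C B \<Psi>' \<Psi>) \<Phi>"
    by (rule dist_comp_assoc[OF A B C B \<Phi> adj'(1,2)])
  moreover have "dist_le Q A B (dist_comp Q A B B (dist_id B) \<Phi>)
      (dist_comp Q A B B (dist_comp Q B C B \<Psi>' \<Psi>) \<Phi>)"
    by (rule dist_comp_mono[OF A B B \<Phi> \<Phi> dist_le_refl[OF \<Phi>] distributor_dist_id[OF B]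
          distributor_dist_comp[OF B C B adj'(1,2)] adj'(3)])
  ultimately show ?thesis by (simp add: dist_comp_id_left[OF A B \<Phi>])
qed

lemma dist_left_adjoint_comp:
  assumes A: "q_category Q A" and B: "q_category Q B" and C: "q_category Q C"
    and adj1: "dist_left_adjoint Q A B \<Phi> \<Phi>'" and adj2: "dist_left_adjoint Q B C \<Psi> \<Psi>'"
  shows "dist_left_adjoint Q A C (dist_comp Q A B C \<Psi> \<Phi>) (dist_comp Q C B A \<Phi>' \<Psi>')"
  unfolding dist_left_adjoint_def
proof (intro conjI)
  note adj1' = dist_left_adjointD[OF adj1] and adj2' = dist_left_adjointD[OF adj2]
  show l: "distributor Q A C (dist_comp Q A B C \<Psi> \<Phi>)"
    by (rule distributor_dist_comp[OF A B C adj1'(1) adj2'(1)])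
  show r: "distributor Q C A (dist_comp Q C B A \<Phi>' \<Psi>')"
    by (rule distributor_dist_comp[OF C B A adj2'(2) adj1'(2)])
  have lB: "distributor Q A B (dist_comp Q A C B \<Psi>' (dist_comp Q A B C \<Psi> \<Phi>))"
    by (rule distributor_dist_comp[OF A C B l adj2'(2)])
  have "dist_le Q A A (dist_comp Q A B A \<Phi>' \<Phi>)
      (dist_comp Q A B A \<Phi>' (dist_comp Q A C B \<Psi>' (dist_comp Q A B C \<Psi> \<Phi>)))"
    by (rule dist_comp_mono[OF A B A adj1'(1) lB left_adjoint_unit_le[OF A B C adj2 adj1'(1)]
          adj1'(2) adj1'(2) dist_le_refl[OF adj1'(2)]])
  with adj1'(3) have "dist_le Q A A (dist_id A)
      (dist_comp Q A B A \<Phi>' (dist_comp Q A C B \<Psi>' (dist_comp Q A B C \<Psi> \<Phi>)))"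
    by (rule dist_le_trans[OF _ _ distributor_dist_id[OF A]
          distributor_dist_comp[OF A B A adj1'(1,2)] distributor_dist_comp[OF A B A lB adj1'(2)]])
  then show "dist_le Q A A (dist_id A)
      (dist_comp Q A C A (dist_comp Q C B A \<Phi>' \<Psi>') (dist_comp Q A B C \<Psi> \<Phi>))"
    by (simp add: dist_comp_assoc[OF A C B A l adj2'(2) adj1'(2)])
  have rB: "distributor Q C B (dist_comp Q C A B \<Phi> (dist_comp Q C B A \<Phi>' \<Psi>'))"
    by (rule distributor_dist_comp[OF C A B r adj1'(1)])
  have "dist_le Q C C (dist_comp Q C B C \<Psi> (dist_comp Q C A B \<Phi> (dist_comp Q C B A \<Phi>' \<Psi>')))
      (dist_comp Q C B C \<Psi> \<Psi>')"
    by (rule dist_comp_mono[OF C B C rB adj2'(2) left_adjoint_counit_le[OF C A B adj1 adj2'(2)]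
          adj2'(1) adj2'(1) dist_le_refl[OF adj2'(1)]])
  from this adj2'(4) have "dist_le Q C C
      (dist_comp Q C B C \<Psi> (dist_comp Q C A B \<Phi> (dist_comp Q C B A \<Phi>' \<Psi>'))) (dist_id C)"
    by (rule dist_le_trans[OF _ _ distributor_dist_comp[OF C B C rB adj2'(1)]
          distributor_dist_comp[OF C B C adj2'(2,1)] distributor_dist_id[OF C]])
  then show "dist_le Q C C
      (dist_comp Q C A C (dist_comp Q A B C \<Psi> \<Phi>) (dist_comp Q C B A \<Phi>' \<Psi>')) (dist_id C)"
    by (simp add: dist_comp_assoc[OF C A B C r adj1'(1) adj2'(1)])
qed

lemma cauchy_distributor_comp:
  "\<lbrakk>q_category Q A; q_category Q B; q_category Q C;
    cauchy_distributor Q A B \<Phi>; cauchy_distributor Q B C \<Psi>\<rbrakk>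
    \<Longrightarrow> cauchy_distributor Q A C (dist_comp Q A B C \<Psi> \<Phi>)"
  unfolding cauchy_distributor_def using dist_left_adjoint_comp by blast

lemma cauchy_functor_dist:
  "\<lbrakk>q_category Q A; q_category Q B; q_functor Q A B F\<rbrakk> \<Longrightarrow> cauchy_distributor Q A B (functor_dist A B F)"
  unfolding cauchy_distributor_def using functor_dist_left_adjoint by blast

text \<open>Lifting through a left adjoint \<open>\<Psi>\<close> is composition with its right adjoint, because
  \<open>\<Psi> \<otimes> Y \<le> \<Phi>\<close> is equivalent to \<open>Y \<le> \<Psi>' \<otimes> \<Phi>\<close>. So the hom-arrows of the Cauchy completion are
  composites, whose suprema are explicit.\<close>

lemma dist_lift_left_adjoint:
  assumes A: "q_category Q A" and B: "q_category Q B" and C: "q_category Q C"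
    and adj: "dist_left_adjoint Q B C \<Psi> \<Psi>'" and \<Phi>: "distributor Q A C \<Phi>"
  shows "dist_lift Q A B C \<Psi> \<Phi> = dist_comp Q A C B \<Psi>' \<Phi>"
  unfolding dist_lift_def
proof (rule the_equality)
  note adj' = dist_left_adjointD[OF adj]
  have d: "distributor Q A B (dist_comp Q A C B \<Psi>' \<Phi>)"
    by (rule distributor_dist_comp[OF A C B \<Phi> adj'(2)])
  have max: "dist_le Q A B Y (dist_comp Q A C B \<Psi>' \<Phi>)"
    if Y: "distributor Q A B Y" and le: "dist_le Q A C (dist_comp Q A B C \<Psi> Y) \<Phi>" for Y
  proof (rule dist_le_trans[OF left_adjoint_unit_le[OF A B C adj Y] _ Y _ d])
    note \<Psi>Y = distributor_dist_comp[OF A B C Y adj'(1)]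
    show "distributor Q A B (dist_comp Q A C B \<Psi>' (dist_comp Q A B C \<Psi> Y))"
      by (rule distributor_dist_comp[OF A C B \<Psi>Y adj'(2)])
    show "dist_le Q A B (dist_comp Q A C B \<Psi>' (dist_comp Q A B C \<Psi> Y)) (dist_comp Q A C B \<Psi>' \<Phi>)"
      by (rule dist_comp_mono[OF A C B \<Psi>Y \<Phi> le adj'(2) adj'(2) dist_le_refl[OF adj'(2)]])
  qed
  show greatest: "distributor Q A B (dist_comp Q A C B \<Psi>' \<Phi>)
      \<and> dist_le Q A C (dist_comp Q A B C \<Psi> (dist_comp Q A C B \<Psi>' \<Phi>)) \<Phi>
      \<and> (\<forall>Y. distributor Q A B Y \<and> dist_le Q A C (dist_comp Q A B C \<Psi> Y) \<Phi>
          \<longrightarrow> dist_le Q A B Y (dist_comp Q A C B \<Psi>' \<Phi>))"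
    using d left_adjoint_counit_le[OF A B C adj \<Phi>] max by blast
  fix X
  assume X: "distributor Q A B X \<and> dist_le Q A C (dist_comp Q A B C \<Psi> X) \<Phi>
      \<and> (\<forall>Y. distributor Q A B Y \<and> dist_le Q A C (dist_comp Q A B C \<Psi> Y) \<Phi> \<longrightarrow> dist_le Q A B Y X)"
  show "X = dist_comp Q A C B \<Psi>' \<Phi>"
    by (rule dist_le_antisym[OF max _ _ d]) (use X greatest in blast)+
qed


section \<open>Cauchy completeness is a property of presheaves\<close>

lemma q_category_one_object:
  assumes "C \<in> Ob Q"
  shows "q_category Q \<lparr>Objs = {x}, ty = \<lambda>_. C, hom = \<lambda>_ _. Ident Q C\<rparr>"
  using assms ident_closed[OF assms] comp_ident_left[OF ident_closed[OF assms]]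
    leq_refl[OF ident_closed[OF assms]]
  by (simp add: q_category_def)

lemma q_category_star: "C \<in> Ob Q \<Longrightarrow> q_category Q (star Q C)"
  unfolding star_def by (rule q_category_one_object)

lemma star_simps [simp]: "Objs (star Q C) = {()}" "ty (star Q C) u = C" "hom (star Q C) u v = Ident Q C"
  by (simp_all add: star_def)

definition point :: "'x \<Rightarrow> unit \<Rightarrow> 'x" where
  "point a = (\<lambda>u\<in>{()}. a)"

lemma point_apply [simp]: "point a u = a"
  by (simp add: point_def)

lemma q_functor_point:
  assumes "q_category Q A" "a \<in> Objs A"
  shows "q_functor Q (star Q (ty A a)) A (point a)"
  using q_categoryD(4)[OF assms] assms(2) by (auto simp: q_functor_def PiE_def extensional_def)

text \<open>A Cauchy distributor from \<open>C\<close> is representable as soon as each of its columns, a Cauchy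
  presheaf, is: choose a representing object for every column.\<close>

lemma cauchy_completeI:
  assumes B: "q_category Q B"
    and rep: "\<And>D \<phi>. \<lbrakk>D \<in> Ob Q; cauchy_distributor Q (star Q D) B \<phi>\<rbrakk>
      \<Longrightarrow> \<exists>b\<in>Objs B. ty B b = D \<and> (\<forall>b'\<in>Objs B. \<phi> (b', ()) = hom B b' b)"
  shows "cauchy_complete TYPE('c) Q B"
  unfolding cauchy_complete_def
proof (intro conjI allI impI; (elim conjE)?)
  show "q_category Q B" by (rule B)
next
  fix C :: "('o, 'm, 'c) qcat" and \<Phi>
  assume C: "q_category Q C" and cauchy: "cauchy_distributor Q C B \<Phi>"
  have \<Phi>: "distributor Q C B \<Phi>"
    using cauchy dist_left_adjointD(1) unfolding cauchy_distributor_def by blast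
  have "\<exists>b. b \<in> Objs B \<and> ty B b = ty C c \<and> (\<forall>b'\<in>Objs B. \<Phi> (b', c) = hom B b' b)"
    if c: "c \<in> Objs C" for c
  proof -
    note pt = q_functor_point[OF C c] and st = q_category_star[OF q_categoryD(1)[OF C c]]
    have "cauchy_distributor Q (star Q (ty C c)) B
        (dist_comp Q (star Q (ty C c)) C B \<Phi> (functor_dist (star Q (ty C c)) C (point c)))"
      by (rule cauchy_distributor_comp[OF st C B cauchy_functor_dist[OF st C pt] cauchy])
    from rep[OF q_categoryD(1)[OF C c] this] show ?thesis
      by (auto simp: dist_comp_functor_dist[OF st C B pt \<Phi>])
  qed
  then obtain f where f: "\<And>c. c \<in> Objs C
      \<Longrightarrow> f c \<in> Objs B \<and> ty B (f c) = ty C c \<and> (\<forall>b'\<in>Objs B. \<Phi> (b', c) = hom B b' (f c))"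
    by metis
  define F where "F = restrict f (Objs C)"
  have "F \<in> Objs C \<rightarrow>\<^sub>E Objs B" "\<And>c. c \<in> Objs C \<Longrightarrow> ty B (F c) = ty C c"
    "\<And>b c. \<lbrakk>b \<in> Objs B; c \<in> Objs C\<rbrakk> \<Longrightarrow> \<Phi> (b, c) = hom B b (F c)"
    using f by (auto simp: F_def)
  from representing_map_is_functor[OF C B \<Phi> this]
  show "\<exists>F. q_functor Q C B F \<and> \<Phi> = functor_dist C B F" by metis
qed

text \<open>The type of the objects of the test categories contains some element; the test category on
  this single object already detects every presheaf.\<close>

lemma cauchy_presheaf_representable:
  assumes cc: "cauchy_complete TYPE('c) Q B" and D: "D \<in> Ob Q"
    and cauchy: "cauchy_distributor Q (star Q D) B \<phi>"
  shows "\<exists>b\<in>Objs B. ty B b = D \<and> (\<forall>b'\<in>Objs B. \<phi> (b', ()) = hom B b' b)"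
proof -
  let ?x = "undefined :: 'c"
  let ?S = "\<lparr>Objs = {?x}, ty = \<lambda>_. D, hom = \<lambda>_ _. Ident Q D\<rparr> :: ('o, 'm, 'c) qcat"
  let ?v = "\<lambda>_\<in>{?x}. ()"
  have B: "q_category Q B" using cc by (simp add: cauchy_complete_def)
  note S = q_category_one_object[OF D, of ?x] and st = q_category_star[OF D]
  have \<phi>: "distributor Q (star Q D) B \<phi>"
    using cauchy dist_left_adjointD(1) unfolding cauchy_distributor_def by blast
  have v: "q_functor Q ?S (star Q D) ?v"
    using leq_refl[OF ident_closed[OF D]] by (auto simp: q_functor_def)
  have "cauchy_distributor Q ?S B (dist_comp Q ?S (star Q D) B \<phi> (functor_dist ?S (star Q D) ?v))"
    by (rule cauchy_distributor_comp[OF S st B cauchy_functor_dist[OF S st v] cauchy])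
  then obtain F where F: "q_functor Q ?S B F"
    and eq: "dist_comp Q ?S (star Q D) B \<phi> (functor_dist ?S (star Q D) ?v) = functor_dist ?S B F"
    using cc S unfolding cauchy_complete_def by blast
  have "\<phi> (b', ()) = hom B b' (F ?x)" if "b' \<in> Objs B" for b'
    using dist_comp_functor_dist[OF S st B v \<phi> that, of ?x] that
    by (simp add: eq) (simp add: functor_dist_def)
  then show ?thesis using q_functorD(2,3)[OF F, of ?x] by auto
qed

lemma cauchy_complete_type_independent:
  assumes "cauchy_complete TYPE('c) Q B"
  shows "cauchy_complete TYPE('d) Q B"
  using assms cauchy_presheaf_representable[OF assms]
  by (intro cauchy_completeI) (auto simp: cauchy_complete_def)

lemma cauchy_distributor_representable:
  fixes C :: "('o, 'm, 'd) qcat"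
  assumes "cauchy_complete TYPE('c) Q B" "q_category Q C" "cauchy_distributor Q C B \<Phi>"
  shows "\<exists>F. q_functor Q C B F \<and> functor_dist C B F = \<Phi>"
  using cauchy_complete_type_independent[OF assms(1), where 'd = 'd] assms(2,3)
  unfolding cauchy_complete_def by metis


section \<open>The Cauchy completion\<close>

lemma completion_Objs_iff:
  "(C, \<phi>) \<in> Objs (cauchy_completion Q A) \<longleftrightarrow> C \<in> Ob Q \<and> cauchy_distributor Q (star Q C) A \<phi>"
  by (simp add: cauchy_completion_def)

lemma completion_ty [simp]: "ty (cauchy_completion Q A) = fst"
  by (simp add: cauchy_completion_def)

lemma completion_ObjsE:
  assumes "p \<in> Objs (cauchy_completion Q A)"
  obtains C \<phi> \<phi>' where "p = (C, \<phi>)" "C \<in> Ob Q" "dist_left_adjoint Q (star Q C) A \<phi> \<phi>'"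
  using assms by (cases p) (auto simp: completion_Objs_iff cauchy_distributor_def)

lemma completion_hom:
  assumes A: "q_category Q A" and C: "C \<in> Ob Q" and D: "D \<in> Ob Q"
    and adj: "dist_left_adjoint Q (star Q D) A \<psi> \<psi>'" and \<phi>: "distributor Q (star Q C) A \<phi>"
  shows "hom (cauchy_completion Q A) (D, \<psi>) (C, \<phi>) = dist_comp Q (star Q C) A (star Q D) \<psi>' \<phi> ((), ())"
  using dist_lift_left_adjoint[OF q_category_star[OF C] q_category_star[OF D] A adj \<phi>]
  by (simp add: cauchy_completion_def)

text \<open>Composition and identities in the completion are the counit and the unit of the adjunctions
  \<open>\<psi> \<stileturn> \<psi>'\<close>: \<open>(\<chi>' \<otimes> \<psi>) \<otimes> (\<psi>' \<otimes> \<phi>) \<le> \<chi>' \<otimes> \<phi>\<close> and \<open>1 \<le> \<psi>' \<otimes> \<psi>\<close>.\<close>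

lemma q_category_completion:
  assumes A: "q_category Q A"
  shows "q_category Q (cauchy_completion Q A)"
  unfolding q_category_def
proof (intro conjI ballI)
  let ?P = "cauchy_completion Q A"
  fix p assume "p \<in> Objs ?P"
  then show "ty ?P p \<in> Ob Q" by (auto elim!: completion_ObjsE)
next
  let ?P = "cauchy_completion Q A"
  fix p' p assume "p' \<in> Objs ?P" "p \<in> Objs ?P"
  then obtain D \<psi> \<psi>' C \<phi> \<phi>' where p': "p' = (D, \<psi>)" "D \<in> Ob Q" "dist_left_adjoint Q (star Q D) A \<psi> \<psi>'"
    and p: "p = (C, \<phi>)" "C \<in> Ob Q" "dist_left_adjoint Q (star Q C) A \<phi> \<phi>'"
    by (elim completion_ObjsE)
  note \<phi> = dist_left_adjointD(1)[OF p(3)] and \<psi>' = dist_left_adjointD(2)[OF p'(3)]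
  show "hom ?P p' p \<in> Hom Q (ty ?P p) (ty ?P p')"
    using dist_comp_closed[OF q_category_star[OF p(2)] A q_category_star[OF p'(2)] \<phi> \<psi>', of "()" "()"]
    by (simp add: p'(1) p(1) completion_hom[OF A p(2) p'(2,3) \<phi>])
next
  let ?P = "cauchy_completion Q A"
  fix p'' p' p assume "p'' \<in> Objs ?P" "p' \<in> Objs ?P" "p \<in> Objs ?P"
  then obtain E \<chi> \<chi>' D \<psi> \<psi>' C \<phi> \<phi>'
    where p'': "p'' = (E, \<chi>)" "E \<in> Ob Q" "dist_left_adjoint Q (star Q E) A \<chi> \<chi>'"
      and p': "p' = (D, \<psi>)" "D \<in> Ob Q" "dist_left_adjoint Q (star Q D) A \<psi> \<psi>'"
      and p: "p = (C, \<phi>)" "C \<in> Ob Q" "dist_left_adjoint Q (star Q C) A \<phi> \<phi>'"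
    by (elim completion_ObjsE)
  let ?C = "star Q C" and ?D = "star Q D" and ?E = "star Q E"
  note cat = q_category_star[OF p(2)] q_category_star[OF p'(2)] q_category_star[OF p''(2)]
  note \<phi> = dist_left_adjointD(1)[OF p(3)] and \<psi> = dist_left_adjointD(1,2)[OF p'(3)]
    and \<chi>' = dist_left_adjointD(2)[OF p''(3)]
  note \<psi>\<phi> = distributor_dist_comp[OF cat(1) A cat(2) \<phi> \<psi>(2)]
    and \<chi>\<psi> = distributor_dist_comp[OF cat(2) A cat(3) \<psi>(1) \<chi>']
    and \<chi>\<phi> = distributor_dist_comp[OF cat(1) A cat(3) \<phi> \<chi>']
  note \<chi>\<psi>\<phi> = distributor_dist_comp[OF cat \<psi>\<phi> \<chi>\<psi>]
  have "dist_le Q ?C ?E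
      (dist_comp Q ?C A ?E \<chi>' (dist_comp Q ?C ?D A \<psi> (dist_comp Q ?C A ?D \<psi>' \<phi>)))
      (dist_comp Q ?C A ?E \<chi>' \<phi>)"
    by (rule dist_comp_mono[OF cat(1) A cat(3) distributor_dist_comp[OF cat(1,2) A \<psi>\<phi> \<psi>(1)] \<phi>
          left_adjoint_counit_le[OF cat(1,2) A p'(3) \<phi>] \<chi>' \<chi>' dist_le_refl[OF \<chi>']])
  then have le: "dist_comp Q ?C ?D ?E (dist_comp Q ?D A ?E \<chi>' \<psi>) (dist_comp Q ?C A ?D \<psi>' \<phi>) ((), ())
      \<sqsubseteq> dist_comp Q ?C A ?E \<chi>' \<phi> ((), ())"
    by (simp add: dist_comp_assoc[OF cat(1,2) A cat(3) \<psi>\<phi> \<psi>(1) \<chi>'] dist_le_def)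
  have "dist_comp Q ?D A ?E \<chi>' \<psi> ((), ()) \<cdot> dist_comp Q ?C A ?D \<psi>' \<phi> ((), ())
      \<sqsubseteq> dist_comp Q ?C A ?E \<chi>' \<phi> ((), ())"
    by (rule leq_trans[OF dist_comp_upper[OF cat \<psi>\<phi> \<chi>\<psi>] le dist_comp_term_closed[OF cat \<psi>\<phi> \<chi>\<psi>]
          distributorD(2)[OF \<chi>\<psi>\<phi>] distributorD(2)[OF \<chi>\<phi>]]) simp_all
  then show "hom ?P p'' p' \<cdot> hom ?P p' p \<sqsubseteq> hom ?P p'' p"
    by (simp add: p''(1) p'(1) p(1) completion_hom[OF A p'(2) p''(2,3) \<psi>(1)]
        completion_hom[OF A p(2) p'(2,3) \<phi>] completion_hom[OF A p(2) p''(2,3) \<phi>])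
next
  let ?P = "cauchy_completion Q A"
  fix p assume "p \<in> Objs ?P"
  then obtain C \<phi> \<phi>' where p: "p = (C, \<phi>)" "C \<in> Ob Q" "dist_left_adjoint Q (star Q C) A \<phi> \<phi>'"
    by (elim completion_ObjsE)
  note adj = dist_left_adjointD[OF p(3)]
  show "Ident Q (ty ?P p) \<sqsubseteq> hom ?P p p"
    using adj(3) by (simp add: p(1) completion_hom[OF A p(2) p(2,3) adj(1)] dist_le_def dist_id_def)
qed

text \<open>The right adjoint of the representable presheaf \<open>A(-,a)\<close> is \<open>A(a,-)\<close>, so that homs from and
  to representables are evaluations (the Yoneda lemma).\<close>

lemma cc_unit_eq:
  "a \<in> Objs A \<Longrightarrow> cc_unit Q A a = (ty A a, functor_dist (star Q (ty A a)) A (point a))"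
  by (auto simp: cc_unit_def functor_dist_def)

lemma cc_unit_mem:
  assumes A: "q_category Q A" and a: "a \<in> Objs A"
  shows "cc_unit Q A a \<in> Objs (cauchy_completion Q A)"
  using cauchy_functor_dist[OF q_category_star[OF q_categoryD(1)[OF A a]] A q_functor_point[OF A a]]
    q_categoryD(1)[OF A a]
  by (simp add: cc_unit_eq[OF a] completion_Objs_iff)

lemma hom_cc_unit_left:
  assumes A: "q_category Q A" and a: "a \<in> Objs A" and p: "(C, \<phi>) \<in> Objs (cauchy_completion Q A)"
  shows "hom (cauchy_completion Q A) (cc_unit Q A a) (C, \<phi>) = \<phi> (a, ())"
proof -
  have C: "C \<in> Ob Q" and \<phi>: "distributor Q (star Q C) A \<phi>"
    using p dist_left_adjointD(1) by (auto simp: completion_Objs_iff cauchy_distributor_def)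
  note ta = q_categoryD(1)[OF A a] and pt = q_functor_point[OF A a]
  note st = q_category_star[OF ta] and stC = q_category_star[OF C]
  show ?thesis
    by (simp add: cc_unit_eq[OF a]
        completion_hom[OF A C ta functor_dist_left_adjoint[OF st A pt] \<phi>]
        functor_codist_dist_comp[OF stC A st pt \<phi>])
qed

lemma hom_cc_unit_right:
  assumes A: "q_category Q A" and a: "a \<in> Objs A" and D: "D \<in> Ob Q"
    and adj: "dist_left_adjoint Q (star Q D) A \<psi> \<psi>'"
  shows "hom (cauchy_completion Q A) (D, \<psi>) (cc_unit Q A a) = \<psi>' ((), a)"
proof -
  note ta = q_categoryD(1)[OF A a] and pt = q_functor_point[OF A a]
  note st = q_category_star[OF ta] and stD = q_category_star[OF D]
  show ?thesis
    by (simp add: cc_unit_eq[OF a] completion_hom[OF A ta D adj distributor_functor_dist[OF st A pt]]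
        dist_comp_functor_dist[OF st A stD pt dist_left_adjointD(2)[OF adj]])
qed

lemma hom_cc_unit:
  assumes A: "q_category Q A" and a: "a' \<in> Objs A" "a \<in> Objs A"
  shows "hom (cauchy_completion Q A) (cc_unit Q A a') (cc_unit Q A a) = hom A a' a"
  using hom_cc_unit_left[OF A a(1) cc_unit_mem[OF A a(2), unfolded cc_unit_eq[OF a(2)]]]
    cc_unit_eq[OF a(2)] a
  by (simp add: functor_dist_def)

lemma q_functor_cc_unit:
  assumes A: "q_category Q A"
  shows "q_functor Q A (cauchy_completion Q A) (cc_unit Q A)"
proof -
  have "cc_unit Q A \<in> Objs A \<rightarrow>\<^sub>E Objs (cauchy_completion Q A)"
    using cc_unit_mem[OF A] by (auto simp: cc_unit_def)
  moreover have "fst (cc_unit Q A a) = ty A a" if "a \<in> Objs A" for a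
    using that by (simp add: cc_unit_def)
  ultimately show ?thesis
    using leq_refl[OF q_categoryD(2)[OF A]] by (simp add: q_functor_def hom_cc_unit[OF A])
qed

abbreviation unit_dist where
  "unit_dist A \<equiv> functor_dist A (cauchy_completion Q A) (cc_unit Q A)"

abbreviation unit_codist where
  "unit_codist A \<equiv> functor_codist A (cauchy_completion Q A) (cc_unit Q A)"

text \<open>With \<open>p = (D, \<psi>)\<close> and \<open>\<psi>'\<close> right adjoint to \<open>\<psi>\<close>, both sides are the supremum of
  \<open>\<psi>'(a) \<cdot> \<phi>(a)\<close>. The lemma turns a Cauchy column \<open>\<phi>\<close> of a distributor \<open>X\<close> into \<open>A\<close> into an object of
  the completion that represents the corresponding column of \<open>unit_dist A \<otimes> X\<close>; it yields in
  turn the isomorphism below, completeness, and the functoriality of \<open>cc_map\<close>.\<close>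

lemma unit_dist_comp_column:
  assumes A: "q_category Q A" and p: "p \<in> Objs (cauchy_completion Q A)"
    and q: "(ty C c, \<phi>) \<in> Objs (cauchy_completion Q A)" and c: "c \<in> Objs C"
    and column: "\<And>a. a \<in> Objs A \<Longrightarrow> X (a, c) = \<phi> (a, ())"
  shows "dist_comp Q C A (cauchy_completion Q A) (unit_dist A) X (p, c)
    = hom (cauchy_completion Q A) p (ty C c, \<phi>)"
proof -
  obtain D \<psi> \<psi>' where p': "p = (D, \<psi>)" "D \<in> Ob Q" "dist_left_adjoint Q (star Q D) A \<psi> \<psi>'"
    using p by (elim completion_ObjsE)
  have tc: "ty C c \<in> Ob Q" and \<phi>: "distributor Q (star Q (ty C c)) A \<phi>"
    using q dist_left_adjointD(1) by (auto simp: completion_Objs_iff cauchy_distributor_def)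
  have "(\<lambda>a. unit_dist A (p, a) \<cdot> X (a, c)) ` Objs A = (\<lambda>a. \<psi>' ((), a) \<cdot> \<phi> (a, ())) ` Objs A"
    by (rule image_cong) (use p column hom_cc_unit_right[OF A _ p'(2,3)] p'(1) in
      \<open>auto simp: functor_dist_def\<close>)
  then show ?thesis
    using p c by (simp add: dist_comp_apply p'(1) completion_hom[OF A tc p'(2,3) \<phi>])
qed

text \<open>The distributors induced by the unit are mutually inverse: \<open>A\<close> and its Cauchy completion are
  isomorphic in the quantaloid of distributors.\<close>

lemma unit_codist_apply:
  "\<lbrakk>q_category Q A; a \<in> Objs A; (C, \<phi>) \<in> Objs (cauchy_completion Q A)\<rbrakk>
    \<Longrightarrow> unit_codist A (a, (C, \<phi>)) = \<phi> (a, ())"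
  by (simp add: functor_codist_def hom_cc_unit_left)

lemma unit_dist_unit_codist:
  assumes A: "q_category Q A"
  shows "dist_comp Q (cauchy_completion Q A) A (cauchy_completion Q A) (unit_dist A) (unit_codist A)
    = dist_id (cauchy_completion Q A)"
proof (rule distributor_eqI)
  let ?P = "cauchy_completion Q A"
  note P = q_category_completion[OF A] and i = q_functor_cc_unit[OF A]
  show "distributor Q ?P ?P (dist_comp Q ?P A ?P (unit_dist A) (unit_codist A))"
    by (rule distributor_dist_comp[OF P A P distributor_functor_codist[OF A P i]
          distributor_functor_dist[OF A P i]])
  show "distributor Q ?P ?P (dist_id ?P)" by (rule distributor_dist_id[OF P])
  fix p q assume p: "p \<in> Objs ?P" and q: "q \<in> Objs ?P"
  obtain C \<phi> where q': "q = (C, \<phi>)" by (cases q)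
  show "dist_comp Q ?P A ?P (unit_dist A) (unit_codist A) (p, q) = dist_id ?P (p, q)"
    using unit_dist_comp_column[OF A p, where C = ?P and c = q and \<phi> = \<phi> and X = "unit_codist A"]
      unit_codist_apply[OF A] p q by (simp add: q' dist_id_def)
qed

lemma unit_codist_unit_dist:
  assumes A: "q_category Q A"
  shows "dist_comp Q A (cauchy_completion Q A) A (unit_codist A) (unit_dist A) = dist_id A"
proof (rule distributor_eqI)
  let ?P = "cauchy_completion Q A"
  note P = q_category_completion[OF A] and i = q_functor_cc_unit[OF A]
  note J = distributor_functor_dist[OF A P i]
  show "distributor Q A A (dist_comp Q A ?P A (unit_codist A) (unit_dist A))"
    by (rule distributor_dist_comp[OF A P A J distributor_functor_codist[OF A P i]])
  show "distributor Q A A (dist_id A)" by (rule distributor_dist_id[OF A])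
  fix a' a assume "a' \<in> Objs A" "a \<in> Objs A"
  then show "dist_comp Q A ?P A (unit_codist A) (unit_dist A) (a', a) = dist_id A (a', a)"
    using functor_codist_dist_comp[OF A P A i J] hom_cc_unit[OF A] cc_unit_mem[OF A]
    by (simp add: dist_id_def functor_dist_def)
qed

lemma cauchy_unit_codist:
  assumes A: "q_category Q A"
  shows "cauchy_distributor Q (cauchy_completion Q A) A (unit_codist A)"
proof -
  note P = q_category_completion[OF A] and i = q_functor_cc_unit[OF A]
  have "dist_left_adjoint Q (cauchy_completion Q A) A (unit_codist A) (unit_dist A)"
    using distributor_functor_dist[OF A P i] distributor_functor_codist[OF A P i]
      dist_le_refl[OF distributor_dist_id[OF A]] dist_le_refl[OF distributor_dist_id[OF P]]
    by (simp add: dist_left_adjoint_def unit_dist_unit_codist[OF A] unit_codist_unit_dist[OF A])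
  then show ?thesis unfolding cauchy_distributor_def by blast
qed

text \<open>A Cauchy presheaf \<open>\<Phi>\<close> on the completion restricts along the isomorphism to a Cauchy presheaf
  on \<open>A\<close>. The latter is an object of the completion, and it represents \<open>\<Phi>\<close>.\<close>

theorem completion_cauchy_complete:
  assumes A: "q_category Q A"
  shows "cauchy_complete TYPE('c) Q (cauchy_completion Q A)"
proof (rule cauchy_completeI)
  let ?P = "cauchy_completion Q A"
  show P: "q_category Q ?P" by (rule q_category_completion[OF A])
  note i = q_functor_cc_unit[OF A]
  note J = distributor_functor_dist[OF A P i] and J' = distributor_functor_codist[OF A P i]
  fix D \<Phi> assume D: "D \<in> Ob Q" and cauchy: "cauchy_distributor Q (star Q D) ?P \<Phi>"
  let ?D = "star Q D"
  note st = q_category_star[OF D]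
  have \<Phi>: "distributor Q ?D ?P \<Phi>"
    using cauchy dist_left_adjointD(1) unfolding cauchy_distributor_def by blast
  let ?\<phi> = "dist_comp Q ?D ?P A (unit_codist A) \<Phi>"
  have b: "(D, ?\<phi>) \<in> Objs ?P"
    using cauchy_distributor_comp[OF st P A cauchy cauchy_unit_codist[OF A]] D
    by (simp add: completion_Objs_iff)
  have eq: "dist_comp Q ?D A ?P (unit_dist A) ?\<phi> = \<Phi>"
    using dist_comp_assoc[OF st P A P \<Phi> J' J] dist_comp_id_left[OF st P \<Phi>]
    by (simp add: unit_dist_unit_codist[OF A])
  have "\<Phi> (p, ()) = hom ?P p (D, ?\<phi>)" if p: "p \<in> Objs ?P" for p
    using unit_dist_comp_column[OF A p, where C = ?D and c = "()" and \<phi> = ?\<phi> and X = ?\<phi>] b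
    by (simp add: eq)
  then show "\<exists>b\<in>Objs ?P. ty ?P b = D \<and> (\<forall>p\<in>Objs ?P. \<Phi> (p, ()) = hom ?P p b)"
    using b by (intro bexI[of _ "(D, ?\<phi>)"]) simp_all
qed


section \<open>Functoriality of the completion\<close>

lemma cc_map_apply:
  "(C, \<phi>) \<in> Objs (cauchy_completion Q A)
    \<Longrightarrow> cc_map Q A B F (C, \<phi>) = (C, dist_comp Q (star Q C) A B (functor_dist A B F) \<phi>)"
  by (simp add: cc_map_def)

lemma cc_map_mem:
  assumes A: "q_category Q A" and B: "q_category Q B" and F: "q_functor Q A B F"
    and p: "(C, \<phi>) \<in> Objs (cauchy_completion Q A)"
  shows "(C, dist_comp Q (star Q C) A B (functor_dist A B F) \<phi>) \<in> Objs (cauchy_completion Q B)"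
  using p cauchy_distributor_comp[OF q_category_star A B _ cauchy_functor_dist[OF A B F]]
  by (auto simp: completion_Objs_iff)

text \<open>Up to the isomorphisms between a \<open>Q\<close>-category and its completion, the distributor induced by
  \<open>cc_map Q A B F\<close> is the one induced by \<open>F\<close>. This makes it functorial and monotone in \<open>F\<close>.\<close>

lemma
  assumes A: "q_category Q A" and B: "q_category Q B" and F: "q_functor Q A B F"
  shows q_functor_cc_map: "q_functor Q (cauchy_completion Q A) (cauchy_completion Q B) (cc_map Q A B F)"
    and functor_dist_cc_map:
      "functor_dist (cauchy_completion Q A) (cauchy_completion Q B) (cc_map Q A B F)
        = dist_comp Q (cauchy_completion Q A) B (cauchy_completion Q B) (unit_dist B)
            (dist_comp Q (cauchy_completion Q A) A B (functor_dist A B F) (unit_codist A))"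
proof -
  let ?P = "cauchy_completion Q A" and ?R = "cauchy_completion Q B"
  let ?X = "dist_comp Q ?P A B (functor_dist A B F) (unit_codist A)"
  note P = q_category_completion[OF A] and R = q_category_completion[OF B]
  have X: "distributor Q ?P B ?X"
    by (rule distributor_dist_comp[OF P A B
          distributor_functor_codist[OF A P q_functor_cc_unit[OF A]] distributor_functor_dist[OF A B F]])
  have d: "distributor Q ?P ?R (dist_comp Q ?P B ?R (unit_dist B) ?X)"
    by (rule distributor_dist_comp[OF P B R X
          distributor_functor_dist[OF B R q_functor_cc_unit[OF B]]])
  have maps: "cc_map Q A B F \<in> Objs ?P \<rightarrow>\<^sub>E Objs ?R"
  proof (rule PiE_I)
    fix p assume "p \<in> Objs ?P"
    then show "cc_map Q A B F p \<in> Objs ?R"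
      by (cases p) (simp add: cc_map_apply cc_map_mem[OF A B F])
  qed (simp add: cc_map_def)
  have types: "ty ?R (cc_map Q A B F p) = ty ?P p" if "p \<in> Objs ?P" for p
    using that by (cases p) (simp add: cc_map_apply)
  have column: "?X (b, (C, \<phi>)) = dist_comp Q (star Q C) A B (functor_dist A B F) \<phi> (b, ())"
    if "(C, \<phi>) \<in> Objs ?P" "b \<in> Objs B" for b C \<phi>
  proof -
    have "(\<lambda>a. functor_dist A B F (b, a) \<cdot> unit_codist A (a, (C, \<phi>))) ` Objs A
        = (\<lambda>a. functor_dist A B F (b, a) \<cdot> \<phi> (a, ())) ` Objs A"
      by (rule image_cong) (use that unit_codist_apply[OF A] in auto)
    then show ?thesis using that by (simp add: dist_comp_apply)
  qed
  have rep: "dist_comp Q ?P B ?R (unit_dist B) ?X (r, p) = hom ?R r (cc_map Q A B F p)"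
    if r: "r \<in> Objs ?R" and p: "p \<in> Objs ?P" for r p
  proof -
    obtain C \<phi> where p': "p = (C, \<phi>)" by (cases p)
    show ?thesis
      using unit_dist_comp_column[OF B r, where C = ?P and c = p and X = ?X
          and \<phi> = "dist_comp Q (star Q C) A B (functor_dist A B F) \<phi>"]
        cc_map_mem[OF A B F] column p by (simp add: p' cc_map_apply)
  qed
  show "q_functor Q ?P ?R (cc_map Q A B F)"
    and "functor_dist ?P ?R (cc_map Q A B F) = dist_comp Q ?P B ?R (unit_dist B) ?X"
    using representing_map_is_functor[OF P R d maps types rep] by blast+
qed

lemma cc_map_mono:
  assumes A: "q_category Q A" and B: "q_category Q B"
    and F: "q_functor Q A B F" and G: "q_functor Q A B G" and le: "functor_le Q A B F G"
  shows "functor_le Q (cauchy_completion Q A) (cauchy_completion Q B) (cc_map Q A B F) (cc_map Q A B G)"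
proof -
  note P = q_category_completion[OF A] and R = q_category_completion[OF B]
  note J = distributor_functor_dist[OF B R q_functor_cc_unit[OF B]]
    and J' = distributor_functor_codist[OF A P q_functor_cc_unit[OF A]]
  note Fd = distributor_functor_dist[OF A B F] and Gd = distributor_functor_dist[OF A B G]
  have "dist_le Q (cauchy_completion Q A) B
      (dist_comp Q (cauchy_completion Q A) A B (functor_dist A B F) (unit_codist A))
      (dist_comp Q (cauchy_completion Q A) A B (functor_dist A B G) (unit_codist A))"
    by (rule dist_comp_mono[OF P A B J' J' dist_le_refl[OF J'] Fd Gd])
      (use le functor_le_iff_dist_le[OF A B F G] in blast)
  from dist_comp_mono[OF P B R distributor_dist_comp[OF P A B J' Fd]
      distributor_dist_comp[OF P A B J' Gd] this J J dist_le_refl[OF J]]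
  show ?thesis
    by (simp add: functor_le_iff_dist_le[OF P R q_functor_cc_map[OF A B F] q_functor_cc_map[OF A B G]]
        functor_dist_cc_map[OF A B F] functor_dist_cc_map[OF A B G])
qed

lemma cc_map_id:
  assumes A: "q_category Q A"
  shows "cc_map Q A A (functor_id A) = functor_id (cauchy_completion Q A)"
proof (rule extensionalityI[of _ "Objs (cauchy_completion Q A)"])
  fix p assume p: "p \<in> Objs (cauchy_completion Q A)"
  then obtain C \<phi> \<phi>' where p': "p = (C, \<phi>)" "C \<in> Ob Q" "dist_left_adjoint Q (star Q C) A \<phi> \<phi>'"
    by (elim completion_ObjsE)
  have "dist_comp Q (star Q C) A A (dist_id A) \<phi> = \<phi>"
    by (rule dist_comp_id_left[OF q_category_star[OF p'(2)] A dist_left_adjointD(1)[OF p'(3)]])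
  then show "cc_map Q A A (functor_id A) p = functor_id (cauchy_completion Q A) p"
    using p by (simp add: p'(1) cc_map_apply functor_dist_id) (simp add: functor_id_def)
qed (simp_all add: cc_map_def functor_id_def)

lemma cc_map_comp:
  assumes A: "q_category Q A" and B: "q_category Q B" and C: "q_category Q C"
    and F: "q_functor Q A B F" and G: "q_functor Q B C G"
  shows "cc_map Q A C (functor_comp A G F)
    = functor_comp (cauchy_completion Q A) (cc_map Q B C G) (cc_map Q A B F)"
proof (rule extensionalityI[of _ "Objs (cauchy_completion Q A)"])
  fix p assume p: "p \<in> Objs (cauchy_completion Q A)"
  then obtain D \<phi> \<phi>' where p': "p = (D, \<phi>)" "D \<in> Ob Q" "dist_left_adjoint Q (star Q D) A \<phi> \<phi>'"
    by (elim completion_ObjsE)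
  note pD = p[unfolded p'(1)]
  show "cc_map Q A C (functor_comp A G F) p
      = functor_comp (cauchy_completion Q A) (cc_map Q B C G) (cc_map Q A B F) p"
    using p dist_comp_assoc[OF q_category_star[OF p'(2)] A B C dist_left_adjointD(1)[OF p'(3)]
        distributor_functor_dist[OF A B F] distributor_functor_dist[OF B C G]]
    by (simp add: functor_comp_def compose_def p'(1) cc_map_apply[OF pD]
        cc_map_apply[OF cc_map_mem[OF A B F pD]])
      (simp add: functor_dist_functor_comp[OF A B C F G, unfolded functor_comp_def compose_def])
qed (simp_all add: cc_map_def functor_comp_def compose_def)

lemma cc_map_unit:
  assumes A: "q_category Q A" and B: "q_category Q B" and F: "q_functor Q A B F" and a: "a \<in> Objs A"
  shows "cc_map Q A B F (cc_unit Q A a) = cc_unit Q B (F a)"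
proof -
  let ?S = "star Q (ty A a)"
  have Fa: "F a \<in> Objs B" "ty B (F a) = ty A a" using q_functorD[OF F] a by auto
  have "functor_comp ?S F (point a) = point (F a)"
    by (auto simp: functor_comp_def compose_def point_def)
  then have "dist_comp Q ?S A B (functor_dist A B F) (functor_dist ?S A (point a))
      = functor_dist ?S B (point (F a))"
    using functor_dist_functor_comp[OF q_category_star[OF q_categoryD(1)[OF A a]] A B
        q_functor_point[OF A a] F] by simp
  then show ?thesis
    using cc_unit_mem[OF A a] a Fa by (simp add: cc_unit_eq cc_map_apply)
qed


section \<open>The universal property\<close>

lemma q_functor_comp:
  assumes A: "q_category Q A" and B: "q_category Q B" and C: "q_category Q C"
    and F: "q_functor Q A B F" and G: "q_functor Q B C G"
  shows "q_functor Q A C (functor_comp A G F)"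
proof (rule representing_map_is_functor(1)[OF A C])
  show "distributor Q A C (dist_comp Q A B C (functor_dist B C G) (functor_dist A B F))"
    by (rule distributor_dist_comp[OF A B C distributor_functor_dist[OF A B F]
          distributor_functor_dist[OF B C G]])
  show "functor_comp A G F \<in> Objs A \<rightarrow>\<^sub>E Objs C" "\<And>a. a \<in> Objs A \<Longrightarrow> ty C (functor_comp A G F a) = ty A a"
    using q_functorD(2,3)[OF F] q_functorD(2,3)[OF G] by (auto simp: functor_comp_def compose_def)
  show "\<And>c a. \<lbrakk>c \<in> Objs C; a \<in> Objs A\<rbrakk> \<Longrightarrow>
      dist_comp Q A B C (functor_dist B C G) (functor_dist A B F) (c, a) = hom C c (functor_comp A G F a)"
    unfolding functor_dist_functor_comp[OF A B C F G, symmetric] by (simp add: functor_dist_def)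
qed

text \<open>Under \<open>F \<mapsto> B(-,F-)\<close>, restriction along the unit becomes composition with the isomorphism
  \<open>unit_dist A\<close>. Composition with the inverse isomorphism \<open>unit_codist A\<close> preserves Cauchy
  distributors, which all come from functors when \<open>B\<close> is Cauchy complete: this gives the inverse.\<close>

theorem restriction_order_equivalence:
  fixes A :: "('o, 'm, 'a) qcat" and B :: "('o, 'm, 'b) qcat"
  assumes A: "q_category Q A" and cc: "cauchy_complete TYPE('c) Q B"
  shows "order_equivalence
    (Functors Q (cauchy_completion Q A) B) (functor_le Q (cauchy_completion Q A) B)
    (Functors Q A B) (functor_le Q A B) (cc_restrict Q A)"
proof -
  let ?P = "cauchy_completion Q A" and ?r = "cc_restrict Q A"
  let ?J = "unit_dist A" and ?J' = "unit_codist A"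
  have B: "q_category Q B" using cc by (simp add: cauchy_complete_def)
  note P = q_category_completion[OF A] and i = q_functor_cc_unit[OF A]
  note J = distributor_functor_dist[OF A P i] and J' = distributor_functor_codist[OF A P i]
  have r_fun: "q_functor Q A B (?r G)"
    and r_dist: "functor_dist A B (?r G) = dist_comp Q A ?P B (functor_dist ?P B G) ?J"
    if G: "q_functor Q ?P B G" for G
    using q_functor_comp[OF A P B i G] functor_dist_functor_comp[OF A P B i G]
    by (simp_all add: cc_restrict_def)
  have "\<exists>G. q_functor Q ?P B G \<and> functor_dist ?P B G = dist_comp Q ?P A B (functor_dist A B H) ?J'"
    if H: "q_functor Q A B H" for H
    by (rule cauchy_distributor_representable[OF cc P
          cauchy_distributor_comp[OF P A B cauchy_unit_codist[OF A] cauchy_functor_dist[OF A B H]]])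
  then obtain e where e_fun: "\<And>H. q_functor Q A B H \<Longrightarrow> q_functor Q ?P B (e H)"
    and e_dist: "\<And>H. q_functor Q A B H
      \<Longrightarrow> functor_dist ?P B (e H) = dist_comp Q ?P A B (functor_dist A B H) ?J'"
    by metis
  have r_mono: "functor_le Q A B (?r G) (?r G')"
    if G: "q_functor Q ?P B G" and G': "q_functor Q ?P B G'" and le: "functor_le Q ?P B G G'" for G G'
  proof -
    have "dist_le Q A B (dist_comp Q A ?P B (functor_dist ?P B G) ?J)
        (dist_comp Q A ?P B (functor_dist ?P B G') ?J)"
      by (rule dist_comp_mono[OF A P B J J dist_le_refl[OF J] distributor_functor_dist[OF P B G]
            distributor_functor_dist[OF P B G']]) (use le functor_le_iff_dist_le[OF P B G G'] in blast)
    then show ?thesis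
      by (simp add: functor_le_iff_dist_le[OF A B r_fun[OF G] r_fun[OF G']] r_dist[OF G] r_dist[OF G'])
  qed
  have e_mono: "functor_le Q ?P B (e H) (e H')"
    if H: "q_functor Q A B H" and H': "q_functor Q A B H'" and le: "functor_le Q A B H H'" for H H'
  proof -
    have "dist_le Q ?P B (dist_comp Q ?P A B (functor_dist A B H) ?J')
        (dist_comp Q ?P A B (functor_dist A B H') ?J')"
      by (rule dist_comp_mono[OF P A B J' J' dist_le_refl[OF J'] distributor_functor_dist[OF A B H]
            distributor_functor_dist[OF A B H']]) (use le functor_le_iff_dist_le[OF A B H H'] in blast)
    then show ?thesis
      by (simp add: functor_le_iff_dist_le[OF P B e_fun[OF H] e_fun[OF H']] e_dist[OF H] e_dist[OF H'])
  qed
  have er: "functor_dist ?P B (e (?r G)) = functor_dist ?P B G" if G: "q_functor Q ?P B G" for G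
  proof -
    note Gd = distributor_functor_dist[OF P B G]
    show ?thesis
      using dist_comp_assoc[OF P A P B J' J Gd] dist_comp_id_right[OF P B Gd]
      by (simp add: e_dist[OF r_fun[OF G]] r_dist[OF G] unit_dist_unit_codist[OF A])
  qed
  have re: "functor_dist A B (?r (e H)) = functor_dist A B H" if H: "q_functor Q A B H" for H
  proof -
    note Hd = distributor_functor_dist[OF A B H]
    show ?thesis
      using dist_comp_assoc[OF A P A B J J' Hd] dist_comp_id_right[OF A B Hd]
      by (simp add: r_dist[OF e_fun[OF H]] e_dist[OF H] unit_codist_unit_dist[OF A])
  qed
  have er_iso: "functor_le Q ?P B (e (?r G)) G \<and> functor_le Q ?P B G (e (?r G))"
    if G: "q_functor Q ?P B G" for G
    using dist_le_refl[OF distributor_functor_dist[OF P B G]]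
    by (simp add: functor_le_iff_dist_le[OF P B e_fun[OF r_fun[OF G]] G]
        functor_le_iff_dist_le[OF P B G e_fun[OF r_fun[OF G]]] er[OF G])
  have re_iso: "functor_le Q A B (?r (e H)) H \<and> functor_le Q A B H (?r (e H))"
    if H: "q_functor Q A B H" for H
    using dist_le_refl[OF distributor_functor_dist[OF A B H]]
    by (simp add: functor_le_iff_dist_le[OF A B r_fun[OF e_fun[OF H]] H]
        functor_le_iff_dist_le[OF A B H r_fun[OF e_fun[OF H]]] re[OF H])
  show ?thesis
    unfolding order_equivalence_def order_preserving_def Functors_def
    using r_fun e_fun r_mono e_mono er_iso re_iso by (intro conjI exI[of _ e]) auto
qed

lemma cc_restrict_functor_comp:
  assumes "q_category Q A"
  shows "cc_restrict Q A (functor_comp (cauchy_completion Q A) H G) = functor_comp A H (cc_restrict Q A G)"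
  using cc_unit_mem[OF assms] by (auto simp: cc_restrict_def functor_comp_def compose_def)

lemma cc_restrict_cc_map:
  assumes A: "q_category Q A" and B: "q_category Q B" and F: "q_functor Q A B F"
  shows "cc_restrict Q A (functor_comp (cauchy_completion Q A) G (cc_map Q A B F))
    = functor_comp A (cc_restrict Q B G) F"
  using cc_unit_mem[OF A] cc_map_unit[OF A B F] q_functorD(2)[OF F]
  by (auto simp: cc_restrict_def functor_comp_def compose_def)

end

theorem proposition7p14:
  fixes Q :: "('o, 'm) quantaloid_data"
    and A :: "('o, 'm, 'a) qcat"
  assumes "quantaloid Q"
    and "q_category Q A"
  shows
    "cauchy_complete TYPE('c) Q (cauchy_completion Q A)
   \<and> cc_unit Q A \<in> Functors Q A (cauchy_completion Q A)
   \<and> (\<forall>B :: ('o, 'm, 'b) qcat. cauchy_complete TYPE('c) Q B \<longrightarrow>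
        order_equivalence
          (Functors Q (cauchy_completion Q A) B) (functor_le Q (cauchy_completion Q A) B)
          (Functors Q A B) (functor_le Q A B)
          (\<lambda>G. cc_restrict Q A G))
   \<and> (\<forall>(B :: ('o, 'm, 'b) qcat) (B' :: ('o, 'm, 'b1) qcat) H G.
        cauchy_complete TYPE('c) Q B \<and> cauchy_complete TYPE('c) Q B' \<and>
        H \<in> Functors Q B B' \<and> G \<in> Functors Q (cauchy_completion Q A) B \<longrightarrow>
        cc_restrict Q A (functor_comp (cauchy_completion Q A) H G)
          = functor_comp A H (cc_restrict Q A G))
   \<and> (\<forall>(A' :: ('o, 'm, 'a1) qcat) F.
        q_category Q A' \<and> F \<in> Functors Q A' A \<longrightarrow>
        cc_map Q A' A F \<in> Functors Q (cauchy_completion Q A') (cauchy_completion Q A) \<and>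
        (\<forall>(B :: ('o, 'm, 'b) qcat) G.
           cauchy_complete TYPE('c) Q B \<and> G \<in> Functors Q (cauchy_completion Q A) B \<longrightarrow>
           cc_restrict Q A' (functor_comp (cauchy_completion Q A') G (cc_map Q A' A F))
             = functor_comp A' (cc_restrict Q A G) F))
   \<and> cc_map Q A A (functor_id A) = functor_id (cauchy_completion Q A)
   \<and> (\<forall>(A' :: ('o, 'm, 'a1) qcat) (A'' :: ('o, 'm, 'a2) qcat) F F'.
        q_category Q A' \<and> q_category Q A'' \<and> F \<in> Functors Q A' A \<and> F' \<in> Functors Q A'' A' \<longrightarrow>
        cc_map Q A'' A (functor_comp A'' F F')
          = functor_comp (cauchy_completion Q A'') (cc_map Q A' A F) (cc_map Q A'' A' F'))
   \<and> (\<forall>(A' :: ('o, 'm, 'a1) qcat) F F'.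
        q_category Q A' \<and> F \<in> Functors Q A' A \<and> F' \<in> Functors Q A' A \<and>
        functor_le Q A' A F F' \<longrightarrow>
        functor_le Q (cauchy_completion Q A') (cauchy_completion Q A)
          (cc_map Q A' A F) (cc_map Q A' A F'))"
proof -
  interpret quantaloid Q by (rule assms(1))
  note A = assms(2)
  show ?thesis
    unfolding Functors_def mem_Collect_eq
  proof (intro conjI allI impI; (elim conjE)?)
    show "cauchy_complete TYPE('c) Q (cauchy_completion Q A)" by (rule completion_cauchy_complete[OF A])
    show "q_functor Q A (cauchy_completion Q A) (cc_unit Q A)" by (rule q_functor_cc_unit[OF A])
    show "cc_map Q A A (functor_id A) = functor_id (cauchy_completion Q A)" by (rule cc_map_id[OF A])
  qed (rule restriction_order_equivalence[OF A, unfolded Functors_def]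
      cc_restrict_functor_comp[OF A] q_functor_cc_map[OF _ A] cc_restrict_cc_map[OF _ A]
      cc_map_comp[OF _ _ A] cc_map_mono[OF _ A]; assumption)+
qed

end
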